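(* Let $(X,\|\cdot\|)$ be a separable real Banach space and let $G$ be a closed subgroup of $\mathrm{Isom}(X,\|\cdot\|)$ (for the strong operator topology) containing $-\mathrm{Id}$. Assume that there exists a (possibly finite) $G$-distinguished sequence $(x_n)_{n\geq 0}$ of points of the unit sphere $S_X$, with dense linear span in $X$, such that the norm $\|\cdot\|$ is LUR in a neighborhood of $x_0$. Then there exists an equivalent norm $|\!|\!|\cdot|\!|\!|$ on $X$ such that $G=\mathrm{Isom}(X,|\!|\!|\cdot|\!|\!|)$.
   Context: $\mathrm{Isom}(X,\|\cdot\|)$ denotes the group of surjective linear isometries of $(X,\|\cdot\|)$, equipped with the strong operator topology (pointwise convergence on $X$). $S_X$ is the unit sphere of $X$. For a group $G$ of linear automorphisms of $X$ and $x_0,\dots,x_{n-1}\in X$, let $G(x_0,\dots,x_{n-1})=\{g\in G : gx_i=x_i \text{ for all } i=0,\dots,n-1\}$, with $G(\emptyset)=G$. A finite or infinite sequence $(x_n)_{n\ge 0}$ in $X$ is distinguished by $G$ (or $G$-distinguished) if for every index $n\geq 0$ the $G(x_0,\dots,x_{n-1})$-orbit of $x_n$ is discrete (as a subset of $X$ in the norm topology). A norm is LUR (locally uniformly rotund) at a point $x\in S_X$ if for every $\epsilon>0$ there is $\delta>0$ such that for all $y\in S_X$, $\|x-y\|\geq\epsilon$ implies $\|x+y\|\leq 2-\delta$. It is LUR in a neighborhood of $x_0\in S_X$ if it is LUR at every point of $S_X$ belonging to some neighborhood of $x_0$. *)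

theory Defs
  imports "HOL-Analysis.Analysis" "HOL-Library.Extended_Nat" "HOL-Algebra.Group"
begin

definition is_norm :: "('a::real_vector \<Rightarrow> real) \<Rightarrow> bool"
  where "is_norm N \<longleftrightarrow>
    (\<forall>x. 0 \<le> N x) \<and> (\<forall>x. N x = 0 \<longleftrightarrow> x = 0) \<and>
    (\<forall>a x. N (a *\<^sub>R x) = \<bar>a\<bar> * N x) \<and> (\<forall>x y. N (x + y) \<le> N x + N y)"

definition equivalent_norm :: "('a::real_normed_vector \<Rightarrow> real) \<Rightarrow> bool"
  where "equivalent_norm N \<longleftrightarrow>
    is_norm N \<and> (\<exists>c>0. \<exists>C>0. \<forall>x. c * norm x \<le> N x \<and> N x \<le> C * norm x)"

text \<open>The carrier is the set of all surjective linear isometries of \<open>N\<close>. It is cut out of the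
  continuous linear maps, which loses nothing when \<open>N\<close> is equivalent to \<^const>\<open>norm\<close>: every
  linear isometry of \<open>N\<close> is then bounded (lemma \<open>carrier_isom_group\<close>).\<close>

definition isom_group :: "('a::real_normed_vector \<Rightarrow> real) \<Rightarrow> ('a \<Rightarrow>\<^sub>L 'a) monoid"
  where "isom_group N =
    \<lparr>carrier = {g. surj (blinfun_apply g) \<and> (\<forall>x. N (g x) = N x)},
     monoid.mult = (o\<^sub>L), one = id_blinfun\<rparr>"

definition pointwise_stabilizer :: "('a::real_normed_vector \<Rightarrow>\<^sub>L 'a) set \<Rightarrow> 'a set \<Rightarrow> ('a \<Rightarrow>\<^sub>L 'a) set"
  where "pointwise_stabilizer G A = {g \<in> G. \<forall>a\<in>A. g a = a}"

text \<open>\<open>L\<close> is the length of the sequence, \<open>\<infinity>\<close> for an infinite one; the values \<open>x n\<close> with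
  \<open>n \<ge> L\<close> are irrelevant. Discreteness is in the subspace topology of the norm topology, so an orbit
  need not be closed or uniformly discrete.\<close>

definition distinguished :: "('a::real_normed_vector \<Rightarrow>\<^sub>L 'a) set \<Rightarrow> enat \<Rightarrow> (nat \<Rightarrow> 'a) \<Rightarrow> bool"
  where "distinguished G L x \<longleftrightarrow>
    (\<forall>n. enat n < L \<longrightarrow> discrete ((\<lambda>g. blinfun_apply g (x n)) ` pointwise_stabilizer G (x ` {..<n})))"

definition LUR_at :: "'a::real_normed_vector \<Rightarrow> bool"
  where "LUR_at x \<longleftrightarrow>
    (\<forall>\<epsilon>>0. \<exists>\<delta>>0. \<forall>y\<in>sphere 0 1. norm (x - y) \<ge> \<epsilon> \<longrightarrow> norm (x + y) \<le> 2 - \<delta>)"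

definition LUR_near :: "'a::real_normed_vector \<Rightarrow> bool"
  where "LUR_near x\<^sub>0 \<longleftrightarrow> (\<exists>U. open U \<and> x\<^sub>0 \<in> U \<and> (\<forall>x\<in>U \<inter> sphere 0 1. LUR_at x))"

lemma equivalent_norm_norm: "equivalent_norm norm"
  unfolding equivalent_norm_def is_norm_def
  by (auto simp: norm_triangle_ineq intro!: exI[of _ 1])

lemma bounded_linear_isometry:
  fixes f :: "'a::real_normed_vector \<Rightarrow> 'a"
  assumes "equivalent_norm N" "linear f" "\<And>x. N (f x) = N x"
  shows "bounded_linear f"
proof -
  obtain c C where c: "c > 0" and *: "\<And>x. c * norm x \<le> N x" "\<And>x. N x \<le> C * norm x"
    using assms(1) unfolding equivalent_norm_def by blast
  have "norm (f x) \<le> norm x * (C / c)" for x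
  proof -
    have "c * norm (f x) \<le> C * norm x"
      using *(1)[of "f x"] *(2)[of x] assms(3)[of x] by linarith
    then show ?thesis using c by (simp add: field_simps)
  qed
  then show ?thesis
    using assms(2) unfolding bounded_linear_def bounded_linear_axioms_def by blast
qed

lemma carrier_isom_group:
  assumes "equivalent_norm N"
  shows "blinfun_apply ` carrier (isom_group N) = {f. linear f \<and> surj f \<and> (\<forall>x. N (f x) = N x)}"
    (is "?L = ?R")
proof
  show "?L \<subseteq> ?R"
    by (auto simp: isom_group_def intro: bounded_linear.linear blinfun.bounded_linear_right)
  show "?R \<subseteq> ?L"
  proof
    fix f assume f: "f \<in> ?R"
    then have "blinfun_apply (Blinfun f) = f"
      using assms by (intro bounded_linear_Blinfun_apply bounded_linear_isometry[of N]) auto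
    with f show "f \<in> ?L"
      by (intro image_eqI[of _ _ "Blinfun f"]) (auto simp: isom_group_def)
  qed
qed

lemma group_isom_group:
  assumes "equivalent_norm N"
  shows "group (isom_group N)"
proof (rule groupI)
  fix g h assume "g \<in> carrier (isom_group N)" "h \<in> carrier (isom_group N)"
  then show "g \<otimes>\<^bsub>isom_group N\<^esub> h \<in> carrier (isom_group N)"
    using comp_surj[of "blinfun_apply h" "blinfun_apply g"]
    by (simp add: isom_group_def o_def)
next
  fix g assume g: "g \<in> carrier (isom_group N)"
  then have g': "linear g" "surj g" "\<And>x. N (g x) = N x"
    using carrier_isom_group[OF assms] by blast+
  have "inj g"
    unfolding linear_injective_0[OF g'(1)]
  proof (intro allI impI)
    fix y assume "g y = 0"
    moreover have zero: "N z = 0 \<longleftrightarrow> z = 0" for z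
      using assms by (simp add: equivalent_norm_def is_norm_def)
    ultimately have "N y = 0" using g'(3)[of y] zero[of 0] by simp
    then show "y = 0" by (simp only: zero)
  qed
  define k where "k = inv_into UNIV g"
  have inv: "g (k y) = y" "k (g y) = y" for y
    using g'(2) \<open>inj g\<close> by (auto simp: k_def surj_f_inv_f)
  have "linear k"
  proof (rule linearI)
    show "k (y + z) = k y + k z" for y z
      using inv(2)[of "k y + k z"] by (simp add: linear_add[OF g'(1)] inv(1))
    show "k (a *\<^sub>R y) = a *\<^sub>R k y" for a y
      using inv(2)[of "a *\<^sub>R k y"] by (simp add: linear_scale[OF g'(1)] inv(1))
  qed
  moreover have "surj k" using inv(2) by (rule surjI)
  moreover have "N (k y) = N y" for y using g'(3)[of "k y"] inv by simp
  ultimately have "k \<in> blinfun_apply ` carrier (isom_group N)"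
    unfolding carrier_isom_group[OF assms] by simp
  then obtain h where h: "h \<in> carrier (isom_group N)" "blinfun_apply h = k"
    by auto
  have "h \<otimes>\<^bsub>isom_group N\<^esub> g = \<one>\<^bsub>isom_group N\<^esub>"
    by (rule blinfun_eqI) (simp add: isom_group_def h(2) inv(2))
  with h(1) show "\<exists>h\<in>carrier (isom_group N). h \<otimes>\<^bsub>isom_group N\<^esub> g = \<one>\<^bsub>isom_group N\<^esub>"
    by blast
qed (simp_all add: isom_group_def blinfun_eqI)

end

theory Submission
  imports Defs
begin

text \<open>
  The new norm \<open>N\<close> is \<open>N v = inf (\<surd>(\<parallel>a\<parallel>\<^sup>2 + t\<^sup>2) + 2 \<parallel>a\<parallel>)\<close> over all decompositions
  \<open>v = a + t k\<close> with \<open>t \<ge> 0\<close> and \<open>k\<close> in the convex hull of a \<open>G\<close>-invariant symmetric set \<open>Z\<close> of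
  unit vectors. The expression is differentiable in \<open>t\<close> but has a vertex at \<open>a = 0\<close>; so points of
  the \<open>N\<close>-sphere that are strongly exposed with a linear modulus lie in the closure of \<open>Z\<close>, whatever
  the original norm looks like, while local uniform rotundity makes every isolated point of \<open>Z\<close>
  exposed in this way. Hence \<open>N\<close>-isometries permute \<open>Z\<close>.

  Here \<open>Z\<close> is the union of the orbits of unit vectors \<open>z\<^sub>0 = x\<^sub>0, z\<^sub>1, z\<^sub>2, \<dots>\<close>, where \<open>z\<^sub>n\<^sub>+\<^sub>1\<close> is
  obtained from \<open>z\<^sub>n\<close> by adding so small a multiple of the next vector of the distinguished sequence
  that an element of \<open>G\<close> fixing \<open>z\<^sub>n\<^sub>+\<^sub>1\<close> fixes \<open>z\<^sub>n\<close>. The distance from \<open>z\<^sub>n\<close> to the rest of \<open>Z\<close> is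
  comparable to \<open>\<parallel>z\<^sub>n\<^sub>+\<^sub>1 - z\<^sub>n\<parallel>\<close>, and these numbers decrease so fast that they label the orbits. So
  an \<open>N\<close>-isometry maps every \<open>z\<^sub>n\<close> into its own orbit, and, the steps being small, it agrees
  on \<open>z\<^sub>0, \<dots>, z\<^sub>n\<close> with one element of \<open>G\<close>. It therefore lies in the strong closure of \<open>G\<close>.
\<close>

section \<open>Norms with spikes\<close>

text \<open>The summand \<open>2 * s\<close> is spent twice in \<open>sharp_spike\<close>: one
  \<open>s\<close> on the slope of the remainder, the other on its distance to the line through the
  spike.\<close>

definition profile :: "real \<Rightarrow> real \<Rightarrow> real"
  where "profile s t = sqrt (s\<^sup>2 + t\<^sup>2) + 2 * s"

lemma profile_zero [simp]: "profile s 0 = 3 * s" if "0 \<le> s"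
  using that by (simp add: profile_def)

lemma profile_zero_left [simp]: "profile 0 t = t" if "0 \<le> t"
  using that by (simp add: profile_def)

lemma profile_ge: "t + 2 * s \<le> profile s t"
  by (simp add: profile_def real_le_rsqrt)

lemma profile_le: "profile s t \<le> 3 * sqrt (s\<^sup>2 + t\<^sup>2)"
proof -
  have "s \<le> sqrt (s\<^sup>2 + t\<^sup>2)" by (simp add: real_le_rsqrt)
  then show ?thesis by (simp add: profile_def)
qed

lemma profile_mono: "profile s t \<le> profile s' t'" if "0 \<le> s" "s \<le> s'" "0 \<le> t" "t \<le> t'"
  using that unfolding profile_def by (intro add_mono real_sqrt_le_mono power_mono) auto

lemma profile_mult: "profile (c * s) (c * t) = c * profile s t" if "0 \<le> c"
proof -
  have "sqrt ((c * s)\<^sup>2 + (c * t)\<^sup>2) = sqrt (c\<^sup>2 * (s\<^sup>2 + t\<^sup>2))"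
    by (simp add: algebra_simps power_mult_distrib)
  also have "\<dots> = c * sqrt (s\<^sup>2 + t\<^sup>2)"
    using that by (simp add: real_sqrt_mult)
  finally show ?thesis by (simp add: profile_def algebra_simps)
qed

lemma profile_add: "profile (s + s') (t + t') \<le> profile s t + profile s' t'"
  using real_sqrt_sum_squares_triangle_ineq[of s s' t t'] by (simp add: profile_def)

text \<open>Concavity: the square root lies below its tangent at
  \<open>s\<^sup>2 + t\<^sup>2\<close>, and \<open>2 * t * h + h\<^sup>2\<close> is the increment of
  the radicand. The sign of \<open>h\<close> is free, so \<open>t\<close> can be perturbed in both
  directions.\<close>

lemma profile_shift:
  assumes "0 < s\<^sup>2 + t\<^sup>2"
  shows "profile s (t + h) \<le> profile s t + (2 * t * h + h\<^sup>2) / (2 * sqrt (s\<^sup>2 + t\<^sup>2))"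
proof -
  define r where "r = sqrt (s\<^sup>2 + t\<^sup>2)"
  have r: "r > 0" and r2: "r\<^sup>2 = s\<^sup>2 + t\<^sup>2"
    using assms by (auto simp: r_def)
  define y where "y = 2 * t * h + h\<^sup>2"
  have y: "s\<^sup>2 + (t + h)\<^sup>2 = r\<^sup>2 + y"
    by (simp add: y_def r2 power2_sum)
  then have y0: "0 \<le> r\<^sup>2 + y"
    by (metis sum_power2_ge_zero)
  have "(r + y / (2 * r))\<^sup>2 = r\<^sup>2 + y + (y / (2 * r))\<^sup>2"
    using r by (simp add: field_simps power2_eq_square)
  then have "r\<^sup>2 + y \<le> (r + y / (2 * r))\<^sup>2" by simp
  moreover have "0 \<le> r + y / (2 * r)"
  proof -
    have "0 \<le> (2 * r\<^sup>2 + y) / (2 * r)"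
      using add_nonneg_nonneg[OF zero_le_power2[of r] y0] r by (simp add: add.assoc)
    also have "(2 * r\<^sup>2 + y) / (2 * r) = r + y / (2 * r)"
      using r by (simp add: field_simps power2_eq_square)
    finally show ?thesis .
  qed
  ultimately have "sqrt (r\<^sup>2 + y) \<le> r + y / (2 * r)"
    using real_le_lsqrt by blast
  then show ?thesis
    unfolding profile_def by (simp add: y y_def r_def)
qed

definition spike_norm :: "'a::real_normed_vector set \<Rightarrow> 'a \<Rightarrow> real"
  where "spike_norm Z v =
    (INF (t, k) \<in> {0..} \<times> (convex hull Z). profile (norm (v - t *\<^sub>R k)) t)"

section \<open>The spike norm as an equivalent norm\<close>

locale spikes =
  fixes Z :: "'a::real_normed_vector set"
  assumes nonempty: "Z \<noteq> {}"
    and unit: "z \<in> Z \<Longrightarrow> norm z = 1"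
    and symmetric: "z \<in> Z \<Longrightarrow> - z \<in> Z"
begin

abbreviation H where "H \<equiv> convex hull Z"
abbreviation N where "N \<equiv> spike_norm Z"

lemma norm_hull: "k \<in> H \<Longrightarrow> norm k \<le> 1"
proof -
  have "H \<subseteq> cball 0 1"
    using unit by (intro hull_minimal) auto
  then show "k \<in> H \<Longrightarrow> norm k \<le> 1" by auto
qed

lemma symmetric_hull: "k \<in> H \<Longrightarrow> - k \<in> H"
proof -
  have "uminus ` H = convex hull (uminus ` Z)"
    by (rule convex_hull_linear_image) (simp add: linear_iff)
  also have "uminus ` Z = Z"
    using symmetric by (force simp: image_iff)
  finally show "k \<in> H \<Longrightarrow> - k \<in> H" by auto
qed

text \<open>The cone over a convex set is closed under addition; this is what makes the infimum
  subadditive.\<close>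

lemma hull_scale_add:
  assumes "k \<in> H" "k' \<in> H" "0 \<le> t" "0 \<le> t'"
  obtains l where "l \<in> H" "t *\<^sub>R k + t' *\<^sub>R k' = (t + t') *\<^sub>R l"
proof (cases "t + t' = 0")
  case True
  then have "t = 0" "t' = 0" using assms by auto
  then show ?thesis using assms that by auto
next
  case False
  define l where "l = (t / (t + t')) *\<^sub>R k + (t' / (t + t')) *\<^sub>R k'"
  have "l \<in> H"
    unfolding l_def using assms False
    by (intro convexD[OF convex_convex_hull]) (auto simp flip: add_divide_distrib)
  moreover have "t *\<^sub>R k + t' *\<^sub>R k' = (t + t') *\<^sub>R l"
    using False by (simp add: l_def scaleR_add_right)
  ultimately show ?thesis using that by blast
qed

lemma norm_le_profile:
  assumes "k \<in> H" "0 \<le> t"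
  shows "norm v \<le> profile (norm (v - t *\<^sub>R k)) t"
proof -
  have "norm v \<le> norm (v - t *\<^sub>R k) + norm (t *\<^sub>R k)"
    using norm_triangle_ineq[of "v - t *\<^sub>R k" "t *\<^sub>R k"] by simp
  also have "norm (t *\<^sub>R k) \<le> t"
    using norm_hull[OF assms(1)] assms(2) by (simp add: mult_left_le)
  finally show ?thesis
    using profile_ge[of t "norm (v - t *\<^sub>R k)"] norm_ge_zero[of "v - t *\<^sub>R k"] by linarith
qed

lemma H_nonempty: "H \<noteq> {}"
  using nonempty by simp

lemma bdd: "bdd_below ((\<lambda>(t, k). profile (norm (v - t *\<^sub>R k)) t) ` ({0..} \<times> H))"
  by (rule bdd_belowI[of _ "norm v"]) (auto intro: norm_le_profile)

lemma N_le: "k \<in> H \<Longrightarrow> 0 \<le> t \<Longrightarrow> N v \<le> profile (norm (v - t *\<^sub>R k)) t"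
  unfolding spike_norm_def by (rule cINF_lower2[OF bdd, of "(t, k)"]) auto

lemma N_le_sum: "k \<in> H \<Longrightarrow> 0 \<le> t \<Longrightarrow> N (a + t *\<^sub>R k) \<le> profile (norm a) t"
  using N_le[of k t "a + t *\<^sub>R k"] by simp

lemma N_greatest:
  assumes "\<And>t k. 0 \<le> t \<Longrightarrow> k \<in> H \<Longrightarrow> c \<le> profile (norm (v - t *\<^sub>R k)) t"
  shows "c \<le> N v"
  unfolding spike_norm_def using H_nonempty by (intro cINF_greatest) (auto intro: assms)

lemma N_approx:
  assumes "0 < e"
  obtains t k where "0 \<le> t" "k \<in> H" "profile (norm (v - t *\<^sub>R k)) t < N v + e"
  using N_greatest[of "N v + e" v] assms that by (meson less_add_same_cancel1 not_le)

lemma norm_le_N: "norm v \<le> N v"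
  by (rule N_greatest) (rule norm_le_profile)

lemma N_le_norm: "N v \<le> 3 * norm v"
proof -
  obtain k where "k \<in> H" using H_nonempty by blast
  then show ?thesis using N_le[of k 0 v] by simp
qed

text \<open>The decomposition with \<open>a = 0\<close> and \<open>t = 1\<close> costs 1, and the
  original norm is a lower bound.\<close>

lemma N_spike: "z \<in> Z \<Longrightarrow> N z = 1"
  using N_le[of z 1 z] norm_le_N[of z] unit[of z] hull_inc[of z Z convex] by simp

lemma N_add: "N (u + v) \<le> N u + N v"
proof (rule field_le_epsilon)
  fix e :: real assume "0 < e"
  then have e: "0 < e / 2" by simp
  obtain t k where 1: "0 \<le> t" "k \<in> H" "profile (norm (u - t *\<^sub>R k)) t < N u + e / 2"
    using N_approx[OF e] .
  obtain t' k' where 2: "0 \<le> t'" "k' \<in> H" "profile (norm (v - t' *\<^sub>R k')) t' < N v + e / 2"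
    using N_approx[OF e] .
  obtain l where l: "l \<in> H" "t *\<^sub>R k + t' *\<^sub>R k' = (t + t') *\<^sub>R l"
    using hull_scale_add 1 2 by metis
  have "N (u + v) \<le> profile (norm (u + v - (t + t') *\<^sub>R l)) (t + t')"
    using N_le l(1) 1 2 by simp
  also have "\<dots> \<le> profile (norm (u - t *\<^sub>R k) + norm (v - t' *\<^sub>R k')) (t + t')"
    using norm_triangle_ineq[of "u - t *\<^sub>R k" "v - t' *\<^sub>R k'"] 1 2
    by (intro profile_mono) (simp_all flip: l(2) add: add_diff_add)
  also have "\<dots> \<le> profile (norm (u - t *\<^sub>R k)) t + profile (norm (v - t' *\<^sub>R k')) t'"
    by (rule profile_add)
  finally show "N (u + v) \<le> N u + N v + e" using 1 2 by linarith
qed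

lemma N_scale: "N (c *\<^sub>R v) = \<bar>c\<bar> * N v"
proof -
  have le: "N (c *\<^sub>R v) \<le> \<bar>c\<bar> * N v" for c v
  proof (cases "c = 0")
    case True
    then show ?thesis using N_le_norm[of 0] by simp
  next
    case False
    have "N (c *\<^sub>R v) / \<bar>c\<bar> \<le> N v"
    proof (rule N_greatest)
      fix t :: real and k assume tk: "0 \<le> t" "k \<in> H"
      have k': "sgn c *\<^sub>R k \<in> H"
        using tk symmetric_hull False by (cases "0 < c") auto
      have "N (c *\<^sub>R v) \<le> profile (norm (c *\<^sub>R v - (\<bar>c\<bar> * t) *\<^sub>R sgn c *\<^sub>R k)) (\<bar>c\<bar> * t)"
        using N_le[OF k'] tk by simp
      also have "c *\<^sub>R v - (\<bar>c\<bar> * t) *\<^sub>R sgn c *\<^sub>R k = c *\<^sub>R (v - t *\<^sub>R k)"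
        by (cases "0 < c") (auto simp: algebra_simps sgn_if)
      also have "profile (norm (c *\<^sub>R (v - t *\<^sub>R k))) (\<bar>c\<bar> * t)
          = \<bar>c\<bar> * profile (norm (v - t *\<^sub>R k)) t"
        by (simp add: profile_mult)
      finally show "N (c *\<^sub>R v) / \<bar>c\<bar> \<le> profile (norm (v - t *\<^sub>R k)) t"
        using False by (simp add: field_simps)
    qed
    then show ?thesis using False by (simp add: field_simps)
  qed
  show ?thesis
  proof (cases "c = 0")
    case True
    then show ?thesis using le[of 0 v] norm_le_N[of 0] by simp
  next
    case False
    have "N (inverse c *\<^sub>R c *\<^sub>R v) \<le> \<bar>inverse c\<bar> * N (c *\<^sub>R v)"
      by (rule le)
    then have "\<bar>c\<bar> * N v \<le> N (c *\<^sub>R v)"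
      using False by (simp add: field_simps)
    then show ?thesis using le[of c v] by linarith
  qed
qed

lemma N_minus: "N (- v) = N v"
  using N_scale[of "-1" v] by simp

lemma N_minus_commute: "N (u - v) = N (v - u)"
  using N_minus[of "u - v"] by simp

lemma equivalent_N: "equivalent_norm N"
proof -
  have "is_norm N"
    unfolding is_norm_def
  proof (intro conjI allI)
    show "0 \<le> N v" for v using norm_le_N[of v] norm_ge_zero[of v] by linarith
    show "N v = 0 \<longleftrightarrow> v = 0" for v
    proof
      show "v = 0" if "N v = 0" using norm_le_N[of v] that by simp
      show "N v = 0" if "v = 0" using norm_le_N[of v] N_le_norm[of v] that by simp
    qed
  qed (auto simp: N_scale N_add)
  moreover have "\<forall>x. 1 * norm x \<le> N x \<and> N x \<le> 3 * norm x"
    using norm_le_N N_le_norm by simp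
  ultimately show ?thesis
    unfolding equivalent_norm_def by (metis zero_less_numeral zero_less_one)
qed

text \<open>Such a map carries decompositions of \<open>v\<close> to decompositions of
  \<open>f v\<close> at the same cost.\<close>

lemma N_image_le:
  assumes "linear f" "\<And>v. norm (f v) = norm v" "f ` Z \<subseteq> Z"
  shows "N (f v) \<le> N v"
proof (rule N_greatest)
  fix t :: real and k assume tk: "0 \<le> t" "k \<in> H"
  have "f k \<in> H"
    using convex_hull_linear_image[OF assms(1), of Z] hull_mono[OF assms(3), of convex] tk by auto
  then have "N (f v) \<le> profile (norm (f v - t *\<^sub>R f k)) t"
    using N_le tk by simp
  also have "f v - t *\<^sub>R f k = f (v - t *\<^sub>R k)"
    by (simp add: linear_diff[OF assms(1)] linear_scale[OF assms(1)])
  finally show "N (f v) \<le> profile (norm (v - t *\<^sub>R k)) t" by (simp add: assms(2))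
qed

end

section \<open>Sharp points\<close>

definition sublinear :: "('a::real_vector \<Rightarrow> real) \<Rightarrow> bool"
  where "sublinear p \<longleftrightarrow>
    (\<forall>u v. p (u + v) \<le> p u + p v) \<and> (\<forall>c u. 0 \<le> c \<longrightarrow> p (c *\<^sub>R u) = c * p u)"

text \<open>A sublinear \<open>p\<close> with \<open>p (- w) = - p w\<close> serves as well as a supporting functional at \<open>w\<close>, and
  \<open>norm_slope\<close> below provides one without the Hahn--Banach theorem. The bound \<open>d\<close> stands for the
  \<open>N\<close>-distance from \<open>u\<close> to the line through \<open>w\<close>.\<close>

definition sharp :: "('a::real_vector \<Rightarrow> real) \<Rightarrow> 'a \<Rightarrow> bool"
  where "sharp N w \<longleftrightarrow> (\<exists>p \<eta>. sublinear p \<and> p w = 1 \<and> p (- w) = - 1 \<and> 0 < \<eta> \<and>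
    (\<forall>u d. (\<forall>c. d \<le> N (u - c *\<^sub>R w)) \<longrightarrow> p u + \<eta> * d \<le> N u))"

lemma sublinear_compose:
  assumes "linear f" "sublinear p"
  shows "sublinear (\<lambda>u. p (f u))"
  using assms by (simp add: sublinear_def linear_add linear_scale)

text \<open>Sharpness refers only to \<open>N\<close> and the linear structure, so it is transported
  by composing \<open>p\<close> with the inverse map \<open>S\<close>.\<close>

lemma sharp_image:
  assumes S: "linear S" "\<And>u. S (T u) = u" and T: "linear T" "\<And>u. T (S u) = u"
    and N: "\<And>u. N (S u) = N u" and "sharp N w"
  shows "sharp N (T w)"
proof -
  obtain p \<eta> where p: "sublinear p" "p w = 1" "p (- w) = - 1" "0 < \<eta>"
    and d: "\<And>u d. (\<forall>c. d \<le> N (u - c *\<^sub>R w)) \<Longrightarrow> p u + \<eta> * d \<le> N u"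
    using assms(6) unfolding sharp_def by blast
  have "p (S u) + \<eta> * d \<le> N u" if "\<forall>c. d \<le> N (u - c *\<^sub>R T w)" for u d
  proof -
    have "d \<le> N (S u - c *\<^sub>R w)" for c
      using that N[of "u - c *\<^sub>R T w"] by (simp add: linear_diff[OF S(1)] linear_scale[OF S(1)] S(2))
    then show ?thesis using d[of d "S u"] N by simp
  qed
  moreover have "p (S (- T w)) = - 1"
    using p by (simp add: linear_neg[OF S(1)] S(2))
  ultimately show ?thesis
    unfolding sharp_def using p S
    by (intro exI[of _ "\<lambda>u. p (S u)"] exI[of _ \<eta>]) (auto intro: sublinear_compose)
qed

text \<open>For a unit vector \<open>z\<close> this is the right derivative of the norm at
  \<open>z\<close> in direction \<open>u\<close>: with \<open>A = 1 / h\<close> the terms are the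
  difference quotients \<open>(norm (z + h *\<^sub>R u) - norm z) / h\<close>, which decrease as
  \<open>h\<close> tends to 0.\<close>

definition norm_slope :: "'a::real_normed_vector \<Rightarrow> 'a \<Rightarrow> real"
  where "norm_slope z u = (INF A\<in>{0..}. norm (u + A *\<^sub>R z) - A)"

context
  fixes z :: "'a::real_normed_vector"
  assumes z: "norm z = 1"
begin

lemma norm_slope_lower: "0 \<le> A \<Longrightarrow> - norm u \<le> norm (u + A *\<^sub>R z) - A"
  using norm_triangle_ineq4[of "u + A *\<^sub>R z" u] z by simp

lemma norm_slope_le: "0 \<le> A \<Longrightarrow> norm_slope z u \<le> norm (u + A *\<^sub>R z) - A"
  unfolding norm_slope_def
  by (rule cINF_lower) (auto intro!: bdd_belowI[of _ "- norm u"] norm_slope_lower)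

lemma norm_slope_greatest:
  "(\<And>A. 0 \<le> A \<Longrightarrow> c \<le> norm (u + A *\<^sub>R z) - A) \<Longrightarrow> c \<le> norm_slope z u"
  unfolding norm_slope_def by (rule cINF_greatest) auto

lemma norm_slope_le_norm: "norm_slope z u \<le> norm u"
  using norm_slope_le[of 0 u] by simp

lemma norm_slope_approx:
  assumes "0 < e"
  obtains A where "0 \<le> A" "norm (u + A *\<^sub>R z) - A < norm_slope z u + e"
  using norm_slope_greatest[of "norm_slope z u + e" u] assms that
  by (meson less_add_same_cancel1 not_le)

lemma norm_slope_self: "norm_slope z z = 1"
proof (rule antisym)
  show "norm_slope z z \<le> 1" using norm_slope_le_norm[of z] z by simp
  show "1 \<le> norm_slope z z"
  proof (rule norm_slope_greatest)
    fix A :: real assume "0 \<le> A"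
    moreover have "z + A *\<^sub>R z = (1 + A) *\<^sub>R z" by (simp add: scaleR_add_left)
    ultimately show "1 \<le> norm (z + A *\<^sub>R z) - A" using z by simp
  qed
qed

lemma norm_slope_minus_self: "norm_slope z (- z) = - 1"
proof (rule antisym)
  show "norm_slope z (- z) \<le> - 1" using norm_slope_le[of 1 "- z"] by simp
  show "- 1 \<le> norm_slope z (- z)"
    using norm_slope_lower[of _ "- z"] z by (intro norm_slope_greatest) simp
qed

lemma sublinear_norm_slope: "sublinear (norm_slope z)"
  unfolding sublinear_def
proof (intro conjI allI impI)
  fix u v
  show "norm_slope z (u + v) \<le> norm_slope z u + norm_slope z v"
  proof (rule field_le_epsilon)
    fix e :: real assume "0 < e"
    then have e: "0 < e / 2" by simp
    obtain A where A: "0 \<le> A" "norm (u + A *\<^sub>R z) - A < norm_slope z u + e / 2"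
      using norm_slope_approx[OF e] .
    obtain B where B: "0 \<le> B" "norm (v + B *\<^sub>R z) - B < norm_slope z v + e / 2"
      using norm_slope_approx[OF e] .
    have "norm_slope z (u + v) \<le> norm ((u + A *\<^sub>R z) + (v + B *\<^sub>R z)) - (A + B)"
      using norm_slope_le[of "A + B" "u + v"] A B by (simp add: algebra_simps)
    also have "\<dots> \<le> norm (u + A *\<^sub>R z) + norm (v + B *\<^sub>R z) - (A + B)"
      using norm_triangle_ineq by (rule diff_right_mono)
    finally show "norm_slope z (u + v) \<le> norm_slope z u + norm_slope z v + e"
      using A B by linarith
  qed
next
  fix c :: real and u
  have le: "norm_slope z (c *\<^sub>R u) \<le> c * norm_slope z u" if "0 < c" for c u
  proof -
    have "norm_slope z (c *\<^sub>R u) / c \<le> norm_slope z u"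
    proof (rule norm_slope_greatest)
      fix A :: real assume A: "0 \<le> A"
      have "norm_slope z (c *\<^sub>R u) \<le> norm (c *\<^sub>R (u + A *\<^sub>R z)) - c * A"
        using norm_slope_le[of "c * A" "c *\<^sub>R u"] A that by (simp add: algebra_simps)
      also have "\<dots> = c * (norm (u + A *\<^sub>R z) - A)"
        using that by (simp add: right_diff_distrib)
      finally show "norm_slope z (c *\<^sub>R u) / c \<le> norm (u + A *\<^sub>R z) - A"
        using that by (simp add: field_simps)
    qed
    then show ?thesis using that by (simp add: field_simps)
  qed
  assume "0 \<le> c"
  then consider "c = 0" | "0 < c" by fastforce
  then show "norm_slope z (c *\<^sub>R u) = c * norm_slope z u"
  proof cases
    case 1
    have "norm_slope z 0 = 0"
    proof (rule antisym)
      show "norm_slope z 0 \<le> 0" using norm_slope_le_norm[of 0] by simp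
      show "0 \<le> norm_slope z 0" using norm_slope_lower[of _ 0] by (intro norm_slope_greatest) simp
    qed
    with 1 show ?thesis by simp
  next
    case 2
    have "norm_slope z (inverse c *\<^sub>R c *\<^sub>R u) \<le> inverse c * norm_slope z (c *\<^sub>R u)"
      using 2 by (intro le) simp
    then have "c * norm_slope z u \<le> norm_slope z (c *\<^sub>R u)"
      using 2 by (simp add: field_simps)
    with le[OF 2, of u] show ?thesis by simp
  qed
qed

end

lemma sublinear_convex_sublevel:
  assumes "sublinear p"
  shows "convex {v. p v \<le> c}"
proof (rule convexI, clarsimp)
  fix v w and a b :: real
  assume vw: "p v \<le> c" "p w \<le> c" and ab: "0 \<le> a" "0 \<le> b" "a + b = 1"
  have "p (a *\<^sub>R v + b *\<^sub>R w) \<le> a * p v + b * p w"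
    using assms ab unfolding sublinear_def by metis
  also have "\<dots> \<le> a * c + b * c"
    using vw ab by (intro add_mono mult_left_mono) auto
  finally show "p (a *\<^sub>R v + b *\<^sub>R w) \<le> c"
    using ab by (simp flip: distrib_right)
qed

section \<open>Spikes and sharp points of the unit sphere\<close>

context spikes
begin

text \<open>Rotundity at \<open>z\<close> pushes the slope at all other spikes below
  \<open>1 - \<delta>\<close>, as they are at distance at least \<open>r\<close>. So on
  \<open>Z\<close>, and by convexity on its hull, the defect \<open>1 - p k\<close> controls the
  distance of \<open>k\<close> to the ray through \<open>z\<close>; the profile controls the
  remainder.\<close>

lemma sharp_spike:
  assumes "z \<in> Z" "LUR_at z" "0 < r" and isolated: "\<And>q. q \<in> Z \<Longrightarrow> q \<noteq> z \<Longrightarrow> r \<le> norm (z - q)"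
  shows "sharp N z"
proof -
  have z: "norm z = 1" using unit assms(1) .
  let ?p = "norm_slope z"
  note sub = sublinear_norm_slope[OF z]
  have p_add: "?p (u + v) \<le> ?p u + ?p v" and p_scale: "0 \<le> c \<Longrightarrow> ?p (c *\<^sub>R u) = c * ?p u" for u v c
    using sub unfolding sublinear_def by auto
  obtain \<delta>' where \<delta>': "0 < \<delta>'" "\<And>y. norm y = 1 \<Longrightarrow> r \<le> norm (z - y) \<Longrightarrow> norm (z + y) \<le> 2 - \<delta>'"
    using assms(2,3) unfolding LUR_at_def by fastforce
  \<comment> \<open>The cap at 1 allows \<open>\<delta> * norm a \<le> norm a\<close> for the
    remainder \<open>a\<close> below.\<close>
  define \<delta> where "\<delta> = min \<delta>' 1"
  have \<delta>: "0 < \<delta>" "\<delta> \<le> 1" "\<delta> \<le> \<delta>'" using \<delta>' by (auto simp: \<delta>_def)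
  \<comment> \<open>The multiple \<open>c\<close> may depend on \<open>k\<close>. This makes the
    condition convex and lets \<open>c = 1\<close> serve at \<open>z\<close> and
    \<open>c = 0\<close> at the other spikes.\<close>
  define K where "K = {k. \<exists>c. 0 \<le> c \<and> \<delta> * norm (k - c *\<^sub>R z) \<le> 1 - ?p k}"
  have "Z \<subseteq> K"
  proof
    fix q assume q: "q \<in> Z"
    show "q \<in> K"
    proof (cases "q = z")
      case True
      then show ?thesis
        unfolding K_def using norm_slope_self[OF z] by (auto intro!: exI[of _ 1])
    next
      case False
      \<comment> \<open>The value \<open>A = 1\<close> in the slope brings in
        \<open>norm (q + z)\<close>, which rotundity bounds.\<close>
      have "?p q \<le> norm (q + z) - 1"
        using norm_slope_le[OF z, of 1 q] by simp
      also have "\<dots> \<le> 1 - \<delta>"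
        using \<delta>'(2)[of q] unit[OF q] isolated[OF q False] \<delta> by (simp add: add.commute)
      finally show ?thesis
        unfolding K_def using unit[OF q] by (auto intro!: exI[of _ 0])
    qed
  qed
  moreover have "convex K"
  proof (rule convexI)
    fix k l and a b :: real
    assume kl: "k \<in> K" "l \<in> K" and ab: "0 \<le> a" "0 \<le> b" "a + b = 1"
    obtain c where c: "0 \<le> c" "\<delta> * norm (k - c *\<^sub>R z) \<le> 1 - ?p k"
      using kl unfolding K_def by blast
    obtain c' where c': "0 \<le> c'" "\<delta> * norm (l - c' *\<^sub>R z) \<le> 1 - ?p l"
      using kl unfolding K_def by blast
    have "norm (a *\<^sub>R k + b *\<^sub>R l - (a * c + b * c') *\<^sub>R z)
        = norm (a *\<^sub>R (k - c *\<^sub>R z) + b *\<^sub>R (l - c' *\<^sub>R z))"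
      by (simp add: algebra_simps)
    also have "\<dots> \<le> a * norm (k - c *\<^sub>R z) + b * norm (l - c' *\<^sub>R z)"
      using norm_triangle_ineq[of "a *\<^sub>R (k - c *\<^sub>R z)" "b *\<^sub>R (l - c' *\<^sub>R z)"] ab by simp
    finally have "\<delta> * norm (a *\<^sub>R k + b *\<^sub>R l - (a * c + b * c') *\<^sub>R z)
        \<le> a * (\<delta> * norm (k - c *\<^sub>R z)) + b * (\<delta> * norm (l - c' *\<^sub>R z))"
      using mult_left_mono[OF _ less_imp_le[OF \<delta>(1)]] by (fastforce simp: distrib_left mult.left_commute)
    also have "\<dots> \<le> a * (1 - ?p k) + b * (1 - ?p l)"
      using c c' ab by (intro add_mono mult_left_mono) auto
    also have "\<dots> = 1 - (a * ?p k + b * ?p l)"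
      using ab by (simp add: algebra_simps)
    also have "\<dots> \<le> 1 - ?p (a *\<^sub>R k + b *\<^sub>R l)"
      using p_add[of "a *\<^sub>R k" "b *\<^sub>R l"] p_scale ab by simp
    finally show "a *\<^sub>R k + b *\<^sub>R l \<in> K"
      unfolding K_def using ab c c' by (intro CollectI exI[of _ "a * c + b * c'"]) simp
  qed
  ultimately have HK: "H \<subseteq> K" by (rule hull_minimal)
  have "?p u + \<delta> / 3 * d \<le> N u" if d: "\<forall>c. d \<le> N (u - c *\<^sub>R z)" for u d
  proof (rule N_greatest)
    fix t :: real and k assume t: "0 \<le> t" and "k \<in> H"
    then obtain c where c: "0 \<le> c" "\<delta> * norm (k - c *\<^sub>R z) \<le> 1 - ?p k"
      using HK unfolding K_def by blast
    let ?a = "u - t *\<^sub>R k"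
    have "u - (t * c) *\<^sub>R z = ?a + t *\<^sub>R (k - c *\<^sub>R z)"
      by (simp add: algebra_simps)
    then have "norm (u - (t * c) *\<^sub>R z) \<le> norm ?a + t * norm (k - c *\<^sub>R z)"
      using norm_triangle_ineq[of ?a "t *\<^sub>R (k - c *\<^sub>R z)"] t
      by (simp only: norm_scaleR abs_of_nonneg)
    then have "\<delta> * norm (u - (t * c) *\<^sub>R z) \<le> \<delta> * (norm ?a + t * norm (k - c *\<^sub>R z))"
      using \<delta> by (intro mult_left_mono) auto
    also have "\<dots> = \<delta> * norm ?a + t * (\<delta> * norm (k - c *\<^sub>R z))"
      by (simp add: algebra_simps)
    also have "\<dots> \<le> norm ?a + t * (1 - ?p k)"
      using \<delta> c t by (intro add_mono mult_left_mono) (auto simp: mult_left_le_one_le)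
    finally have 1: "\<delta> * norm (u - (t * c) *\<^sub>R z) \<le> norm ?a + t * (1 - ?p k)" .
    \<comment> \<open>The bound \<open>d\<close> concerns \<open>N\<close>-distances, hence the
      factor 1/3 in the modulus.\<close>
    have "d \<le> 3 * norm (u - (t * c) *\<^sub>R z)"
      using d N_le_norm order_trans by blast
    then have "\<delta> / 3 * d \<le> \<delta> * norm (u - (t * c) *\<^sub>R z)"
      using \<delta> by (simp add: field_simps)
    moreover have "?p u \<le> norm ?a + t * ?p k"
      using p_add[of ?a "t *\<^sub>R k"] p_scale[OF t] norm_slope_le_norm[OF z, of ?a] by simp
    ultimately show "?p u + \<delta> / 3 * d \<le> profile (norm ?a) t"
      using 1 profile_ge[of t "norm ?a"] by (simp add: algebra_simps)
  qed
  then show ?thesis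
    unfolding sharp_def using sub norm_slope_self[OF z] norm_slope_minus_self[OF z] \<delta>
    by (intro exI[of _ ?p] exI[of _ "\<delta> / 3"]) auto
qed

text \<open>If \<open>w = a + t k\<close> is almost optimal, perturbing it to \<open>w + \<sigma> q\<close> bounds \<open>p q\<close> by the
  \<open>t\<close>-derivative \<open>t / \<rho>\<close> of the profile, less a gain of \<open>\<eta> d\<close> when all spikes stay \<open>d\<close> away from the
  line through \<open>w\<close>; perturbing it to \<open>w - \<sigma> t k\<close> shows that \<open>p k\<close> is almost \<open>t / \<rho>\<close> (if \<open>t\<close> is not
  small, which the symmetry of the spikes ensures).\<close>

lemma spike_near_sharp:
  assumes "N w = 1" "sharp N w" "0 < d"
  shows "\<exists>q\<in>Z. \<exists>c. N (q - c *\<^sub>R w) < d"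
proof (rule ccontr)
  assume "\<not> ?thesis"
  then have far: "d \<le> N (q - c *\<^sub>R w)" if "q \<in> Z" for q c
    using that not_less by blast
  obtain p \<eta> where p: "sublinear p" "p w = 1" "p (- w) = - 1" "0 < \<eta>"
    and gap: "\<And>u d. (\<forall>c. d \<le> N (u - c *\<^sub>R w)) \<Longrightarrow> p u + \<eta> * d \<le> N u"
    using assms(2) unfolding sharp_def by blast
  have p_add: "p (u + v) \<le> p u + p v" and p_scale: "0 \<le> c \<Longrightarrow> p (c *\<^sub>R u) = c * p u" for u v c
    using p(1) unfolding sublinear_def by auto
  \<comment> \<open>The gap inequality with \<open>d = 0\<close>.\<close>
  have p_N: "p u \<le> N u" for u
    using gap[of 0 u] norm_le_N norm_ge_zero order_trans by (metis add.right_neutral mult_zero_right)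
  define x where "x = \<eta> * d"
  have x: "0 < x" using p assms by (simp add: x_def)
  \<comment> \<open>The second bound keeps \<open>x - 3 * \<sigma>\<close> above
    \<open>x / 2\<close>; the third makes the final error \<open>21 * \<sigma>\<close> smaller than
    \<open>x\<^sup>2 / 4\<close>.\<close>
  define \<sigma> where "\<sigma> = min 1 (min (x / 6) (x\<^sup>2 / 100))"
  have \<sigma>: "0 < \<sigma>" "\<sigma> \<le> 1" "3 * \<sigma> \<le> x / 2" "\<sigma> \<le> x\<^sup>2 / 100"
    using x by (auto simp: \<sigma>_def min_def)
  have "0 < \<sigma>\<^sup>2" using \<sigma> by simp
  \<comment> \<open>The tolerance \<open>\<sigma>\<^sup>2\<close> has the order of the second-order
    error of a perturbation of size \<open>\<sigma>\<close>.\<close>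
  then obtain t k where t: "0 \<le> t" and k: "k \<in> H" and tk: "profile (norm (w - t *\<^sub>R k)) t < N w + \<sigma>\<^sup>2"
    by (rule N_approx)
  define s where "s = norm (w - t *\<^sub>R k)"
  define \<rho> where "\<rho> = sqrt (s\<^sup>2 + t\<^sup>2)"
  have s0: "0 \<le> s" by (simp add: s_def)
  have P: "profile s t \<le> 1 + \<sigma>\<^sup>2" using tk assms(1) by (simp add: s_def)
  have "1 \<le> profile s t" using N_le[OF k t, of w] assms(1) by (simp add: s_def)
  then have \<rho>: "1 / 3 \<le> \<rho>" using profile_le[of s t] by (simp add: \<rho>_def)
  then have pos: "0 < s\<^sup>2 + t\<^sup>2" 
    unfolding \<rho>_def by (metis less_le_trans real_sqrt_gt_0_iff zero_less_divide_1_iff zero_less_numeral)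
  have shift: "profile s (t + h) \<le> 1 + \<sigma>\<^sup>2 + t * h / \<rho> + 3 / 2 * h\<^sup>2" for h
  proof -
    have "h\<^sup>2 / (2 * \<rho>) \<le> 3 / 2 * h\<^sup>2"
    proof -
      have "inverse \<rho> \<le> 3" using \<rho> by (simp add: field_simps)
      then have "h\<^sup>2 * inverse \<rho> \<le> h\<^sup>2 * 3" by (intro mult_left_mono) auto
      then show ?thesis by (simp add: field_simps)
    qed
    moreover have "(2 * t * h + h\<^sup>2) / (2 * \<rho>) = t * h / \<rho> + h\<^sup>2 / (2 * \<rho>)"
      using \<rho> by (simp add: field_simps)
    ultimately show ?thesis
      using profile_shift[OF pos, of h] P unfolding \<rho>_def[symmetric] by linarith
  qed
  have t2: "t \<le> 2"
    using profile_ge[of t s] P s0 \<sigma> power_le_one[of \<sigma> 2] by linarith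
  define m where "m = t / \<rho> - x + 3 * \<sigma>"
  have m: "p q \<le> m" if q: "q \<in> Z" for q
  proof -
    obtain l where l: "l \<in> H" "t *\<^sub>R k + \<sigma> *\<^sub>R q = (t + \<sigma>) *\<^sub>R l"
      using hull_scale_add[OF k hull_inc[OF q] t] \<sigma>(1) by (metis less_imp_le)
    have eq: "w + \<sigma> *\<^sub>R q = (w - t *\<^sub>R k) + (t + \<sigma>) *\<^sub>R l"
      by (simp flip: l(2))
    have "N (w + \<sigma> *\<^sub>R q) \<le> profile s (t + \<sigma>)"
      unfolding eq s_def using l t \<sigma> by (intro N_le_sum) auto
    also note shift[of \<sigma>]
    finally have 1: "N (w + \<sigma> *\<^sub>R q) \<le> 1 + \<sigma>\<^sup>2 + t * \<sigma> / \<rho> + 3 / 2 * \<sigma>\<^sup>2" .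
    \<comment> \<open>The line through \<open>w\<close> absorbs the summand \<open>w\<close>, so the
      distance to it is that of \<open>\<sigma> *\<^sub>R q\<close>.\<close>
    have "\<sigma> * d \<le> N (w + \<sigma> *\<^sub>R q - c *\<^sub>R w)" for c
    proof -
      have "w + \<sigma> *\<^sub>R q - c *\<^sub>R w = \<sigma> *\<^sub>R (q - ((c - 1) / \<sigma>) *\<^sub>R w)"
        using \<sigma> by (simp add: scaleR_diff_right scaleR_diff_left)
      then show ?thesis using far[OF q, of "(c - 1) / \<sigma>"] \<sigma> by (simp add: N_scale)
    qed
    then have 2: "p (w + \<sigma> *\<^sub>R q) + \<eta> * (\<sigma> * d) \<le> N (w + \<sigma> *\<^sub>R q)"
      using gap by blast
    have "p (\<sigma> *\<^sub>R q) \<le> p (w + \<sigma> *\<^sub>R q) + p (- w)"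
      using p_add[of "w + \<sigma> *\<^sub>R q" "- w"] by simp
    then have "\<sigma> * p q + \<sigma> * x \<le> \<sigma>\<^sup>2 + t * \<sigma> / \<rho> + 3 / 2 * \<sigma>\<^sup>2"
      using 1 2 p(3) p_scale[of \<sigma> q] \<sigma> by (simp add: x_def mult.left_commute)
    also have "\<dots> \<le> \<sigma> * (t / \<rho> + 3 * \<sigma>)"
      using \<sigma> by (simp add: power2_eq_square algebra_simps)
    finally have "\<sigma> * (p q + x) \<le> \<sigma> * (t / \<rho> + 3 * \<sigma>)" by (simp add: algebra_simps)
    then show ?thesis using \<sigma> by (simp add: m_def)
  qed
  then have "H \<subseteq> {v. p v \<le> m}"
    by (intro hull_minimal sublinear_convex_sublevel p(1)) auto
  \<comment> \<open>Here symmetry enters: the bound at both \<open>k\<close> and \<open>- k\<close>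
    forces \<open>0 \<le> m\<close>, so \<open>t / \<rho>\<close> is at least
    \<open>x - 3 * \<sigma>\<close> and \<open>t\<close> is not small.\<close>
  then have pk: "p k \<le> m" "p (- k) \<le> m" using k symmetric_hull[OF k] by auto
  have "p 0 = 0" using p_scale[of 0 0] by simp
  then have m0: "0 \<le> m" using p_add[of k "- k"] pk by simp
  have "w - (\<sigma> * t) *\<^sub>R k = (w - t *\<^sub>R k) + ((1 - \<sigma>) * t) *\<^sub>R k"
    by (simp add: algebra_simps)
  then have "N (w - (\<sigma> * t) *\<^sub>R k) \<le> profile s ((1 - \<sigma>) * t)"
    unfolding s_def using N_le_sum[OF k, of "(1 - \<sigma>) * t" "w - t *\<^sub>R k"] t \<sigma>
    by (metis diff_ge_0_iff_ge mult_nonneg_nonneg)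
  also have "(1 - \<sigma>) * t = t + - (\<sigma> * t)" by (simp add: algebra_simps)
  also have "profile s (t + - (\<sigma> * t)) \<le> 1 + \<sigma>\<^sup>2 + t * - (\<sigma> * t) / \<rho> + 3 / 2 * (- (\<sigma> * t))\<^sup>2"
    by (rule shift)
  also have "(- (\<sigma> * t))\<^sup>2 \<le> 4 * \<sigma>\<^sup>2"
  proof -
    have "t\<^sup>2 \<le> 2\<^sup>2" using t t2 by (intro power_mono) auto
    then show ?thesis by (simp add: power_mult_distrib mult.commute[of 4] mult_left_mono)
  qed
  finally have 3: "N (w - (\<sigma> * t) *\<^sub>R k) \<le> 1 - \<sigma> * (t * (t / \<rho>)) + 7 * \<sigma>\<^sup>2" 
    by (simp add: algebra_simps)
  have "p w \<le> p (w - (\<sigma> * t) *\<^sub>R k) + \<sigma> * t * p k"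
    using p_add[of "w - (\<sigma> * t) *\<^sub>R k" "(\<sigma> * t) *\<^sub>R k"] p_scale[of "\<sigma> * t" k] t \<sigma> by simp
  then have "1 \<le> 1 - \<sigma> * (t * (t / \<rho>)) + 7 * \<sigma>\<^sup>2 + \<sigma> * t * p k"
    using 3 p_N[of "w - (\<sigma> * t) *\<^sub>R k"] p(2) by linarith
  also have "\<sigma> * t * p k \<le> \<sigma> * t * m"
    using pk t \<sigma> by (intro mult_left_mono) auto
  finally have "0 \<le> \<sigma> * (t * (m - t / \<rho>) + 7 * \<sigma>)"
    by (simp add: algebra_simps power2_eq_square)
  then have "0 \<le> t * (m - t / \<rho>) + 7 * \<sigma>"
    using \<sigma>(1) by (simp add: zero_le_mult_iff)
  then have 4: "t * (x - 3 * \<sigma>) \<le> 7 * \<sigma>"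
    by (simp add: m_def algebra_simps)
  \<comment> \<open>The contradiction: \<open>0 \<le> m\<close> gives \<open>y \<le> 3 * t\<close>,
    and \<open>t * y \<le> 7 * \<sigma>\<close> by the last fact, so
    \<open>y * y \<le> 21 * \<sigma>\<close>, while \<open>y\<close> is at least
    \<open>x / 2\<close>.\<close>
  define y where "y = x - 3 * \<sigma>"
  have y: "x / 2 \<le> y" using \<sigma> by (simp add: y_def)
  have "y \<le> t / \<rho>" using m0 by (simp add: m_def y_def)
  also have "t / \<rho> \<le> 3 * t"
  proof -
    have "inverse \<rho> \<le> 3" using \<rho> by (simp add: field_simps)
    then have "t * inverse \<rho> \<le> t * 3" using t by (intro mult_left_mono) auto
    then show ?thesis by (simp add: field_simps)
  qed
  finally have "y * y \<le> (3 * t) * y"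
    using y x by (intro mult_right_mono) auto
  also have "\<dots> \<le> 21 * \<sigma>" using 4 by (simp add: y_def)
  also have "\<dots> \<le> 21 * (x\<^sup>2 / 100)" using \<sigma> by simp
  finally have "y * y \<le> 21 * (x\<^sup>2 / 100)" .
  moreover have "(x / 2) * (x / 2) \<le> y * y"
    using y x by (intro mult_mono) auto
  moreover have "0 < x\<^sup>2" using x by simp
  ultimately show False by (simp add: power2_eq_square)
qed

text \<open>A spike near the line through \<open>w\<close> is near \<open>w\<close> or
  \<open>- w\<close>, since spikes and \<open>w\<close> have \<open>N\<close>-norm 1; the symmetry
  of \<open>Z\<close> settles the sign.\<close>

lemma sharp_in_closure:
  assumes "N w = 1" "sharp N w"
  shows "w \<in> closure Z"
  unfolding closure_approachable
proof (intro allI impI)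
  fix e :: real assume "0 < e"
  define d where "d = min (e / 2) (1 / 2)"
  have d: "0 < d" "d < 1" "2 * d \<le> e" using \<open>0 < e\<close> by (auto simp: d_def min_def)
  obtain q c where q: "q \<in> Z" and c: "N (q - c *\<^sub>R w) < d"
    using spike_near_sharp[OF assms d(1)] by blast
  have "1 \<le> N (q - c *\<^sub>R w) + \<bar>c\<bar>"
    using N_add[of "q - c *\<^sub>R w" "c *\<^sub>R w"] N_spike[OF q] assms(1) by (simp add: N_scale)
  moreover have "\<bar>c\<bar> \<le> N (q - c *\<^sub>R w) + 1"
    using N_add[of "c *\<^sub>R w - q" q] N_spike[OF q] assms(1) N_minus_commute[of q]
    by (simp add: N_scale)
  ultimately have c1: "\<bar>\<bar>c\<bar> - 1\<bar> < d" using c by linarith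
  then have c0: "c \<noteq> 0" using d by auto
  have "N (q - sgn c *\<^sub>R w) \<le> N (q - c *\<^sub>R w) + N ((c - sgn c) *\<^sub>R w)"
    using N_add[of "q - c *\<^sub>R w" "(c - sgn c) *\<^sub>R w"] by (simp add: algebra_simps)
  also have "N ((c - sgn c) *\<^sub>R w) = \<bar>\<bar>c\<bar> - 1\<bar>"
    using c0 assms(1) by (auto simp: N_scale sgn_if)
  finally have "N (q - sgn c *\<^sub>R w) < e" using c c1 d by linarith
  moreover have "sgn c *\<^sub>R q - w = sgn c *\<^sub>R (q - sgn c *\<^sub>R w)"
    using c0 by (simp add: algebra_simps sgn_if)
  moreover have "\<bar>sgn c\<bar> = 1" using c0 by (simp add: sgn_if)
  ultimately have "N (sgn c *\<^sub>R q - w) < e"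
    by (simp only: N_scale mult_1)
  then have "dist (sgn c *\<^sub>R q) w < e"
    using norm_le_N[of "sgn c *\<^sub>R q - w"] by (simp add: dist_norm)
  moreover have "sgn c *\<^sub>R q \<in> Z"
    using c0 q symmetric by (auto simp: sgn_if)
  ultimately show "\<exists>y\<in>Z. dist y w < e" by blast
qed

text \<open>Isolated LUR spikes are sharp, so their images are sharp and lie in the closure of
  \<open>Z\<close>. Using this for \<open>T\<close> and for \<open>S\<close> removes the
  closure.\<close>

lemma N_isometry_spike:
  assumes S: "linear S" "\<And>u. S (T u) = u" and T: "linear T" "\<And>u. T (S u) = u"
    and N: "\<And>u. N (T u) = N u"
    and Z: "\<And>z. z \<in> Z \<Longrightarrow> LUR_at z"
      "\<And>z. z \<in> Z \<Longrightarrow> \<exists>r>0. \<forall>q\<in>Z. q \<noteq> z \<longrightarrow> r \<le> norm (z - q)"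
    and "z \<in> Z"
  shows "T z \<in> Z"
proof -
  have NS: "N (S u) = N u" for u using N[of "S u"] T(2) by simp
  have sharp: "sharp N q" if "q \<in> Z" for q
    using Z that sharp_spike by blast
  obtain r where r: "0 < r" "\<And>q. q \<in> Z \<Longrightarrow> q \<noteq> z \<Longrightarrow> r \<le> norm (z - q)"
    using Z(2) assms(8) by blast
  have "T z \<in> closure Z"
    using sharp_image[OF S T NS sharp[OF assms(8)]] N N_spike[OF assms(8)]
    by (intro sharp_in_closure) auto
  \<comment> \<open>\<open>Z\<close> need not be closed, so \<open>T z\<close> is approximated by a spike \<open>q\<close>; then \<open>S q\<close> is again sharp and
    too close to the isolated spike \<open>z\<close> to differ from it.\<close>
  then obtain q where q: "q \<in> Z" "dist q (T z) < r / 6"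
    unfolding closure_approachable using r(1) by (meson divide_pos_pos zero_less_numeral)
  have "norm (S q - z) \<le> N (T (S q - z))"
    using norm_le_N N by metis
  also have "T (S q - z) = q - T z" by (simp add: linear_diff[OF T(1)] T(2))
  \<comment> \<open>Passing from the norm to \<open>N\<close> costs a factor 3, which turns
    \<open>r / 6\<close> into \<open>r / 2\<close>.\<close>
  also have "N (q - T z) < r / 2"
    using N_le_norm[of "q - T z"] q(2) by (simp add: dist_norm)
  finally have near: "norm (S q - z) < r / 2" .
  have "S q \<in> closure Z"
    using sharp_image[OF T S N sharp[OF q(1)]] NS N_spike[OF q(1)]
    by (intro sharp_in_closure) auto
  have "S q = z"
  proof (rule ccontr)
    assume "S q \<noteq> z"
    then have "0 < min (r / 2) (norm (S q - z))" using r by simp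
    then obtain q' where q': "q' \<in> Z" "dist q' (S q) < min (r / 2) (norm (S q - z))"
      using \<open>S q \<in> closure Z\<close> unfolding closure_approachable by blast
    have "q' \<noteq> z" using q'(2) by (auto simp: dist_norm norm_minus_commute)
    then have "r \<le> norm (z - q')" using r q' by blast
    also have "\<dots> \<le> norm (S q - z) + dist q' (S q)"
      using norm_triangle_ineq[of "z - S q" "S q - q'"]
      by (simp add: dist_norm norm_minus_commute)
    finally show False using near q'(2) by simp
  qed
  then have "T z = q" using T(2) by metis
  then show ?thesis using q by simp
qed

end

section \<open>Rigid sequences of orbits\<close>

locale isometry_group =
  fixes G :: "('a::real_normed_vector \<Rightarrow>\<^sub>L 'a) set"
  assumes isometry: "g \<in> G \<Longrightarrow> norm (g v) = norm v"
    and compose: "g \<in> G \<Longrightarrow> h \<in> G \<Longrightarrow> g o\<^sub>L h \<in> G"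
    and inverse: "g \<in> G \<Longrightarrow> \<exists>h\<in>G. \<forall>v. h (g v) = v \<and> g (h v) = v"
    and minus_id: "- id_blinfun \<in> G"
begin

lemma id: "id_blinfun \<in> G"
proof -
  have "(- id_blinfun) o\<^sub>L (- id_blinfun) = (id_blinfun :: 'a \<Rightarrow>\<^sub>L 'a)"
    by (rule blinfun_eqI) (simp add: uminus_blinfun.rep_eq)
  then show ?thesis using compose[OF minus_id minus_id] by simp
qed

lemma norm_image_diff: "g \<in> G \<Longrightarrow> norm (g u - g v) = norm (u - v)"
  using isometry[of g "u - v"] by (simp add: blinfun.diff_right)

lemma LUR_at_image:
  assumes "g \<in> G" "LUR_at z"
  shows "LUR_at (g z)"
  unfolding LUR_at_def
proof (intro allI impI)
  fix e :: real assume "0 < e"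
  then obtain \<delta> where \<delta>: "0 < \<delta>" "\<And>y. y \<in> sphere 0 1 \<Longrightarrow> e \<le> norm (z - y) \<Longrightarrow> norm (z + y) \<le> 2 - \<delta>"
    using assms(2) unfolding LUR_at_def by blast
  obtain h where h: "h \<in> G" "\<And>v. h (g v) = v" "\<And>v. g (h v) = v"
    using inverse[OF assms(1)] by blast
  have "norm (g z + y) \<le> 2 - \<delta>" if "y \<in> sphere 0 1" "e \<le> norm (g z - y)" for y
  proof -
    have "norm (z - h y) = norm (g z - y)" "norm (z + h y) = norm (g z + y)"
      using isometry[OF assms(1), of "z - h y"] isometry[OF assms(1), of "z + h y"] h(3)
      by (simp_all add: blinfun.diff_right blinfun.add_right)
    moreover have "h y \<in> sphere 0 1" using that isometry[OF h(1)] by simp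
    ultimately show ?thesis using \<delta>(2)[of "h y"] that by simp
  qed
  then show "\<exists>\<delta>>0. \<forall>y\<in>sphere 0 1. e \<le> norm (g z - y) \<longrightarrow> norm (g z + y) \<le> 2 - \<delta>"
    using \<delta>(1) by blast
qed

definition orbit_gap :: "'a \<Rightarrow> real \<Rightarrow> bool"
  where "orbit_gap z s \<longleftrightarrow> 0 < s \<and> (\<forall>g\<in>G. g z \<noteq> z \<longrightarrow> s \<le> norm (g z - z))"

text \<open>Here \<open>z'\<close> is \<open>z + e v\<close> normalised. An element almost fixing
  \<open>z'\<close> moves \<open>z\<close> by less than its gap, so fixes \<open>z\<close>; then it
  moves \<open>v\<close> by less than \<open>\<sigma>\<close>, so fixes \<open>v\<close> and hence
  \<open>z'\<close>.\<close>

lemma extend_by_small_vector: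
  assumes z: "norm z = 1" "orbit_gap z s"
    and v: "v \<notin> span {z}" "0 < \<sigma>" "\<And>g. g \<in> G \<Longrightarrow> g z = z \<Longrightarrow> g v \<noteq> v \<Longrightarrow> \<sigma> \<le> norm (g v - v)"
  obtains z' s' where "norm z' = 1" "orbit_gap z' s'" "z' \<noteq> z" "norm (z' - z) \<le> s / 100"
    "s' \<le> norm (z' - z)" "v \<in> span {z, z'}" "\<And>g. g \<in> G \<Longrightarrow> g z' = z' \<Longrightarrow> g z = z"
proof -
  have s: "0 < s" and gap: "\<And>g. g \<in> G \<Longrightarrow> norm (g z - z) < s \<Longrightarrow> g z = z"
    using z(2) unfolding orbit_gap_def by force+
  have "v \<noteq> 0" using v(1) span_zero by blast
  \<comment> \<open>The bound 1/2 keeps \<open>norm (z + e v)\<close> between 1/2 and 3/2;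
    normalising at most doubles the error \<open>s / 400\<close>.\<close>
  define e where "e = min (1 / 2) (s / 400) / norm v"
  have e: "0 < e" "e * norm v \<le> 1 / 2" "e * norm v \<le> s / 400"
    using s \<open>v \<noteq> 0\<close> by (auto simp: e_def)
  define y where "y = z + e *\<^sub>R v"
  have yz: "norm (y - z) = e * norm v" using e by (simp add: y_def)
  have y1: "\<bar>norm y - 1\<bar> \<le> e * norm v"
    using norm_triangle_ineq3[of y z] yz z(1) by simp
  then have y: "1 / 2 \<le> norm y" "norm y \<le> 3 / 2" using e by linarith+
  then have "y \<noteq> 0" by auto
  define z' where "z' = y /\<^sub>R norm y"
  have y_z': "y = norm y *\<^sub>R z'" using \<open>y \<noteq> 0\<close> by (simp add: z'_def)
  have z'1: "norm z' = 1" using \<open>y \<noteq> 0\<close> by (simp add: z'_def)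
  have v_eq: "v = inverse e *\<^sub>R (norm y *\<^sub>R z' - z)"
    using e y_z' by (simp add: y_def)
  have ne: "z' \<noteq> z"
  proof
    assume "z' = z"
    then have "v \<in> span {z}"
      by (subst v_eq) (simp add: span_scale span_diff span_base)
    with v(1) show False by simp
  qed
  have "y - z' = (norm y - 1) *\<^sub>R z'" by (subst y_z') (simp add: algebra_simps)
  then have "norm (z' - y) \<le> e * norm v"
    using y1 z'1 by (metis abs_norm_cancel mult.right_neutral norm_minus_commute norm_scaleR real_norm_def)
  then have close: "norm (z' - z) \<le> s / 200"
    using norm_triangle_ineq[of "z' - y" "y - z"] yz e by simp
  \<comment> \<open>The third bound leaves room for two errors \<open>s / 200\<close> below
    \<open>s\<close>; the second survives multiplication by \<open>norm y\<close>, which is at most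
    3/2.\<close>
  define s' where "s' = min (norm (z' - z)) (min (e * \<sigma> / 2) (s / 2))"
  have s': "0 < s'" using ne e v s by (simp add: s'_def)
  have fix_z: "g z = z" if g: "g \<in> G" and small: "norm (g z' - z') < s'" for g
  proof -
    have "norm (g z - z) \<le> norm (g z - g z') + norm (g z' - z') + norm (z' - z)"
      using norm_triangle_ineq[of "g z - g z'" "g z' - z"] norm_triangle_ineq[of "g z' - z'" "z' - z"]
      by simp
    also have "\<dots> < s"
      using small close s norm_image_diff[OF g, of z z'] by (simp add: s'_def norm_minus_commute)
    finally show ?thesis using gap g by blast
  qed
  have "g z' = z'" if g: "g \<in> G" and small: "norm (g z' - z') < s'" for g
  proof -
    have gz: "g z = z" using fix_z g small .
    have "norm y * norm (g z' - z') = norm (norm y *\<^sub>R (g z' - z'))" by simp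
    also have "norm y *\<^sub>R (g z' - z') = g y - y"
      using y_z' by (metis blinfun.scaleR_right scaleR_diff_right)
    also have "g y - y = e *\<^sub>R (g v - v)"
      by (simp add: y_def blinfun.add_right blinfun.scaleR_right gz scaleR_diff_right)
    finally have "e * norm (g v - v) = norm y * norm (g z' - z')" using e by simp
    also have "\<dots> \<le> 3 / 2 * (e * \<sigma> / 2)"
      using y small by (intro mult_mono) (auto simp: s'_def)
    also have "\<dots> < e * \<sigma>" using e v(2) by simp
    finally have "norm (g v - v) < \<sigma>" using e by simp
    then have "g v = v" using v(3)[OF g gz] by force
    then have "g y = y" using gz by (simp add: y_def blinfun.add_right blinfun.scaleR_right)
    then show ?thesis by (simp add: z'_def blinfun.scaleR_right)
  qed
  then have "orbit_gap z' s'"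
    unfolding orbit_gap_def using s' by force
  moreover have "v \<in> span {z, z'}"
    by (subst v_eq) (intro span_scale span_diff span_base, auto)
  moreover have "s' \<le> norm (z' - z)" by (simp add: s'_def)
  moreover have "norm (z' - z) \<le> s / 100" using close s by simp
  moreover have "g z = z" if "g \<in> G" "g z' = z'" for g
    using fix_z that s' by simp
  ultimately show ?thesis using that z'1 ne by blast
qed

end

section \<open>Separation of the orbits of a rigid sequence\<close>

locale rigid_sequence = isometry_group +
  fixes z :: "nat \<Rightarrow> 'a" and s :: "nat \<Rightarrow> real"
  assumes unit: "norm (z n) = 1"
    and gap: "orbit_gap (z n) (s n)"
    and step_neq: "z (Suc n) \<noteq> z n"
    and step_le: "norm (z (Suc n) - z n) \<le> s n / 100"
    and gap_le: "s (Suc n) \<le> norm (z (Suc n) - z n)"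
begin

definition \<tau> where "\<tau> n = norm (z (Suc n) - z n)"

definition Z where "Z = {blinfun_apply g (z n) |g n. g \<in> G}"

lemma tau_pos: "0 < \<tau> n"
  using step_neq by (simp add: \<tau>_def)

lemma tau_gap: "100 * \<tau> n \<le> s n"
  using step_le[of n] by (simp add: \<tau>_def)

lemma gap_fix: "g \<in> G \<Longrightarrow> norm (g (z n) - z n) < s n \<Longrightarrow> g (z n) = z n"
  using gap[of n] unfolding orbit_gap_def by force

text \<open>Gaps and steps interlace: \<open>s (Suc n)\<close> lies between
  \<open>100 * \<tau> (Suc n)\<close> and \<open>\<tau> n\<close>.\<close>

lemma tau_Suc: "100 * \<tau> (Suc n) \<le> \<tau> n"
  using tau_gap[of "Suc n"] gap_le[of n] by (simp add: \<tau>_def)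

lemma tau_less: "n < m \<Longrightarrow> 100 * \<tau> m \<le> \<tau> n"
proof (induction m)
  case (Suc m)
  then show ?case
    using tau_Suc[of m] tau_pos[of "Suc m"] tau_pos[of m] by (cases "n = m") auto
qed simp

lemma tail_le: "norm (z (n + j) - z n) \<le> 2 * \<tau> n"
proof (induction j arbitrary: n)
  case 0
  then show ?case using tau_pos[of n] by simp
next
  case (Suc j)
  have "norm (z (n + Suc j) - z n) \<le> norm (z (Suc n + j) - z (Suc n)) + \<tau> n"
    using norm_triangle_ineq[of "z (Suc n + j) - z (Suc n)" "z (Suc n) - z n"] by (simp add: \<tau>_def)
  also have "\<dots> \<le> 2 * \<tau> (Suc n) + \<tau> n" using Suc.IH[of "Suc n"] by simp
  also have "\<dots> \<le> 2 * \<tau> n" using tau_Suc[of n] tau_pos[of n] by simp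
  finally show ?case .
qed

lemma tail_le': "n \<le> m \<Longrightarrow> norm (z m - z n) \<le> 2 * \<tau> n"
  using tail_le[of n "m - n"] by simp

lemma tail_ge:
  assumes "n < m"
  shows "\<tau> n / 2 \<le> norm (z m - z n)"
proof -
  have "\<tau> n \<le> norm (z m - z (Suc n)) + norm (z m - z n)"
    using norm_triangle_ineq[of "z (Suc n) - z m" "z m - z n"]
    by (simp add: \<tau>_def norm_minus_commute)
  moreover have "norm (z m - z (Suc n)) \<le> 2 * \<tau> (Suc n)"
    using assms by (intro tail_le') simp
  ultimately show ?thesis using tau_Suc[of n] tau_pos[of n] by simp
qed

text \<open>The tail from \<open>i\<close> to \<open>n\<close> is so short that an isometry fixing
  \<open>z n\<close> moves \<open>z i\<close> by less than its gap.\<close>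

lemma stabilizer_mono:
  assumes "g \<in> G" "g (z n) = z n" "i \<le> n"
  shows "g (z i) = z i"
proof (rule gap_fix[OF assms(1)])
  have "norm (g (z i) - z i) \<le> norm (g (z i) - g (z n)) + norm (z n - z i)"
    using norm_triangle_ineq[of "g (z i) - g (z n)" "z n - z i"] assms(2) by simp
  also have "\<dots> \<le> 4 * \<tau> i"
    using tail_le'[OF assms(3)] norm_image_diff[OF assms(1), of "z i" "z n"]
    by (simp add: norm_minus_commute)
  also have "\<dots> < s i" using tau_gap[of i] tau_pos[of i] by simp
  finally show "norm (g (z i) - z i) < s i" .
qed

text \<open>Either \<open>g\<close> fixes \<open>z n\<close> and the distance is that of
  \<open>z m\<close> from \<open>z n\<close>, or \<open>g\<close> moves \<open>z n\<close> by at
  least \<open>s n\<close>, of which the tail from \<open>n\<close> to \<open>m\<close> takes back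
  at most \<open>2 * \<tau> n\<close>.\<close>

lemma orbit_separation_later:
  assumes "g \<in> G" "n \<le> m" "g (z m) \<noteq> z n"
  shows "\<tau> n / 2 \<le> norm (g (z m) - z n)"
proof (cases "g (z n) = z n")
  case True
  then have "n < m" using assms by (cases "n = m") auto
  moreover have "norm (g (z m) - z n) = norm (z m - z n)"
    using norm_image_diff[OF assms(1), of "z m" "z n"] True by simp
  ultimately show ?thesis using tail_ge by simp
next
  case False
  then have "s n \<le> norm (g (z n) - z n)"
    using gap[of n] assms(1) unfolding orbit_gap_def by blast
  also have "\<dots> \<le> norm (g (z m) - z n) + norm (g (z m) - g (z n))"
    using norm_triangle_ineq[of "g (z m) - z n" "g (z n) - g (z m)"]
    by (simp add: norm_minus_commute)
  also have "norm (g (z m) - g (z n)) \<le> 2 * \<tau> n"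
    using tail_le'[OF assms(2)] norm_image_diff[OF assms(1)] by simp
  finally show ?thesis using tau_gap[of n] tau_pos[of n] by simp
qed

lemma orbit_separation:
  assumes "g \<in> G" "g (z m) \<noteq> z n"
  shows "\<tau> n / 2 \<le> norm (g (z m) - z n)"
proof (cases "n \<le> m")
  case True
  then show ?thesis using assms orbit_separation_later by blast
next
  case False
  \<comment> \<open>For \<open>m < n\<close> the inverse of \<open>g\<close> exchanges the roles and
    yields the larger bound \<open>\<tau> m / 2\<close>.\<close>
  obtain h where h: "h \<in> G" "\<And>v. h (g v) = v" "\<And>v. g (h v) = v"
    using inverse[OF assms(1)] by blast
  have "h (z n) \<noteq> z m" using assms(2) h(3) by metis
  then have "\<tau> m / 2 \<le> norm (h (z n) - z m)"
    using False h(1) orbit_separation_later by simp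
  also have "\<dots> = norm (g (z m) - z n)"
    using norm_image_diff[OF assms(1), of "h (z n)" "z m"] h(3) by (simp add: norm_minus_commute)
  finally show ?thesis using tau_less[of m n] tau_pos[of m] tau_pos[of n] False by simp
qed

lemma orbits_isolated:
  assumes "g \<in> G" "q \<in> Z" "q \<noteq> g (z n)"
  shows "\<tau> n / 2 \<le> norm (g (z n) - q)"
proof -
  obtain g' m where g': "g' \<in> G" "q = g' (z m)" using assms(2) by (auto simp: Z_def)
  obtain h where h: "h \<in> G" "\<And>v. h (g v) = v" "\<And>v. g (h v) = v"
    using inverse[OF assms(1)] by blast
  have "(h o\<^sub>L g') (z m) \<noteq> z n" using assms(3) g' h(3) by (metis blinfun_apply_blinfun_compose)
  then have "\<tau> n / 2 \<le> norm ((h o\<^sub>L g') (z m) - z n)"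
    using orbit_separation[OF compose[OF h(1) g'(1)]] by blast
  also have "\<dots> = norm (g (z n) - q)"
    using norm_image_diff[OF assms(1), of "h q" "z n"] h(3) g'(2) by (simp add: norm_minus_commute)
  finally show ?thesis .
qed

lemma Z_image:
  assumes "g \<in> G" "q \<in> Z"
  shows "g q \<in> Z"
proof -
  obtain h n where "h \<in> G" "q = h (z n)" using assms(2) by (auto simp: Z_def)
  then have "g q = (g o\<^sub>L h) (z n)" "g o\<^sub>L h \<in> G" using compose assms(1) by auto
  then show ?thesis unfolding Z_def by blast
qed

lemma z_in_Z: "z n \<in> Z"
proof -
  have "z n = id_blinfun (z n)" by simp
  then show ?thesis unfolding Z_def using id by blast
qed

sublocale spikes Z
proof
  show "Z \<noteq> {}" using z_in_Z by blast
  show "norm q = 1" if "q \<in> Z" for q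
    using that by (auto simp: Z_def isometry unit)
  show "- q \<in> Z" if "q \<in> Z" for q
    using Z_image[OF minus_id that] by (simp add: uminus_blinfun.rep_eq)
qed

lemma N_invariant:
  assumes "g \<in> G"
  shows "N (g v) = N v"
proof -
  have le: "N (g v) \<le> N v" if "g \<in> G" for g v
    using that by (intro N_image_le)
      (auto simp: isometry Z_image bounded_linear.linear blinfun.bounded_linear_right)
  obtain h where h: "h \<in> G" "\<And>v. h (g v) = v" using inverse[OF assms] by blast
  show ?thesis using le[OF assms, of v] le[OF h(1), of "g v"] h(2) by simp
qed

text \<open>\<open>S\<close> moves the neighbour \<open>g (z (Suc m))\<close> of \<open>g (z m)\<close> to a point of \<open>Z\<close> that would be too close to
  \<open>z n\<close> if \<open>m\<close> exceeded \<open>n\<close>.\<close>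

lemma orbit_index_le:
  assumes S: "linear S" "\<And>u. S (T u) = u" "\<And>u. T (S u) = u" "\<And>u. N (S u) = N u"
    and "\<And>q. q \<in> Z \<Longrightarrow> S q \<in> Z" and g: "g \<in> G" "T (z n) = g (z m)"
  shows "m \<le> n"
proof (rule ccontr)
  assume "\<not> m \<le> n"
  let ?q = "g (z (Suc m))"
  have Sz: "S (g (z m)) = z n" using S(2) g(2) by metis
  have "?q \<noteq> g (z m)"
    using norm_image_diff[OF g(1), of "z (Suc m)" "z m"] step_neq[of m] by auto
  then have "S ?q \<noteq> id_blinfun (z n)" using Sz S(3) by (metis id_blinfun.rep_eq id_apply)
  moreover have "S ?q \<in> Z" using assms(5) Z_image[OF g(1) z_in_Z] by blast
  ultimately have "\<tau> n / 2 \<le> norm (z n - S ?q)"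
    using orbits_isolated[OF id, of "S ?q" n] by simp
  also have "\<dots> \<le> N (S (g (z m) - ?q))"
    using norm_le_N Sz by (simp add: linear_diff[OF S(1)])
  also have "\<dots> = N (g (z m) - ?q)" by (rule S(4))
  also have "\<dots> \<le> 3 * \<tau> m"
    using N_le_norm norm_image_diff[OF g(1), of "z m" "z (Suc m)"]
    by (metis \<tau>_def norm_minus_commute)
  finally show False
    using tau_less[of n m] tau_pos[of n] \<open>\<not> m \<le> n\<close> by simp
qed

text \<open>\<open>T (z n)\<close> lies in the orbit of some \<open>z m\<close>, and the index bound
  in both directions gives \<open>m = n\<close>. The resulting elements for \<open>n\<close> and
  \<open>Suc n\<close> nearly agree at \<open>z n\<close>; their quotient moves \<open>z n\<close>
  by less than its gap, so it fixes \<open>z 0\<close> up to \<open>z n\<close>.\<close>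

lemma isometry_agrees:
  assumes LUR: "\<And>n. LUR_at (z n)"
    and S: "linear S" "\<And>u. S (T u) = u" and T: "linear T" "\<And>u. T (S u) = u"
    and N: "\<And>u. N (T u) = N u"
  shows "\<exists>g. \<forall>n. g n \<in> G \<and> (\<forall>i\<le>n. T (z i) = blinfun_apply (g n) (z i))"
proof -
  have NS: "N (S u) = N u" for u using N[of "S u"] T(2) by simp
  have Z_LUR: "LUR_at q" if "q \<in> Z" for q
    using that LUR LUR_at_image by (auto simp: Z_def)
  have Z_iso: "\<exists>r>0. \<forall>q'\<in>Z. q' \<noteq> q \<longrightarrow> r \<le> norm (q - q')" if q: "q \<in> Z" for q
  proof -
    obtain g n where "g \<in> G" "q = g (z n)" using q by (auto simp: Z_def)
    then show ?thesis using orbits_isolated tau_pos[of n]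
      by (intro exI[of _ "\<tau> n / 2"]) auto
  qed
  note spike = N_isometry_spike[OF _ _ _ _ _ Z_LUR Z_iso]
  have TZ: "T q \<in> Z" if "q \<in> Z" for q using spike[OF S T N] that by blast
  have SZ: "S q \<in> Z" if "q \<in> Z" for q using spike[OF T S NS] that by blast
  have "\<exists>g. g \<in> G \<and> T (z n) = g (z n)" for n
  proof -
    obtain g m where g: "g \<in> G" "T (z n) = g (z m)"
      using TZ[OF z_in_Z[of n]] by (auto simp: Z_def)
    obtain h where h: "h \<in> G" "\<And>v. h (g v) = v" "\<And>v. g (h v) = v"
      using inverse[OF g(1)] by blast
    have "m \<le> n" using orbit_index_le[OF S T(2) NS SZ g] .
    \<comment> \<open>\<open>S \<circ> g\<close> sends \<open>z m\<close> to \<open>z n\<close> and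
      has the inverse \<open>h \<circ> T\<close>, so the index bound applies with \<open>m\<close>
      and \<open>n\<close> exchanged and the identity as group element.\<close>
    moreover have "n \<le> m"
    proof (rule orbit_index_le[where S = "\<lambda>u. h (T u)" and T = "\<lambda>u. S (g u)" and g = id_blinfun])
      show "linear (\<lambda>u. h (T u))"
        using linear_compose[OF T(1) bounded_linear.linear[OF blinfun.bounded_linear_right[of h]]]
        by (simp add: o_def)
      show "S (g (z m)) = id_blinfun (z n)" using S(2) g(2) by (metis id_blinfun.rep_eq id_apply)
    qed (auto simp: S T h id N_invariant N TZ Z_image)
    ultimately show ?thesis using g by auto
  qed
  then obtain g where g: "\<And>n. g n \<in> G" "\<And>n. T (z n) = g n (z n)" by metis
  have "\<forall>i\<le>n. T (z i) = g n (z i)" for n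
  proof (induction n)
    case 0
    then show ?case using g by simp
  next
    case (Suc n)
    let ?g = "g (Suc n)"
    obtain h where h: "h \<in> G" "\<And>v. h (g n v) = v" "\<And>v. g n (h v) = v"
      using inverse[OF g(1)[of n]] by blast
    have "norm (T (z (Suc n)) - T (z n)) \<le> N (T (z (Suc n) - z n))"
      using norm_le_N by (simp add: linear_diff[OF T(1)])
    also have "\<dots> \<le> 3 * \<tau> n" unfolding N \<tau>_def by (rule N_le_norm)
    finally have 1: "norm (?g (z (Suc n)) - g n (z n)) \<le> 3 * \<tau> n" using g(2) by simp
    have "norm (h (?g (z n)) - z n) = norm (?g (z n) - g n (z n))"
      using norm_image_diff[OF g(1)[of n], of "h (?g (z n))" "z n"] h(3) by simp
    also have "\<dots> \<le> norm (?g (z n) - ?g (z (Suc n))) + norm (?g (z (Suc n)) - g n (z n))"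
      using norm_triangle_ineq[of "?g (z n) - ?g (z (Suc n))" "?g (z (Suc n)) - g n (z n)"] by simp
    also have "\<dots> \<le> 4 * \<tau> n"
      using 1 norm_image_diff[OF g(1)[of "Suc n"], of "z n" "z (Suc n)"]
      by (simp add: \<tau>_def norm_minus_commute)
    also have "\<dots> < s n" using tau_gap[of n] tau_pos[of n] by simp
    finally have "(h o\<^sub>L ?g) (z n) = z n"
      using gap_fix[OF compose[OF h(1) g(1)]] by simp
    then have "(h o\<^sub>L ?g) (z i) = z i" if "i \<le> n" for i
      using stabilizer_mono[OF compose[OF h(1) g(1)]] that by blast
    then have "?g (z i) = g n (z i)" if "i \<le> n" for i
      using that h(3) by (metis blinfun_apply_blinfun_compose)
    then show ?case using Suc.IH g(2)[of "Suc n"] by (auto simp: le_Suc_eq)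
  qed
  with g(1) show ?thesis by blast
qed

end

section \<open>Construction of a rigid sequence\<close>

context isometry_group
begin

text \<open>Dependent choice of pairs of a point and its gap. The stabilizer of the current point
  fixes \<open>x 0\<close> up to \<open>x n\<close>, so \<open>iso\<close> supplies the gap of
  \<open>x (Suc n)\<close> needed for the next extension. The bound \<open>R\<close> will keep the
  sequence near \<open>x 0\<close>.\<close>

lemma rigid_sequence_exists:
  fixes x :: "nat \<Rightarrow> 'a"
  assumes "norm (x 0) = 1" "x 1 \<notin> span {x 0}" "0 < R"
    and iso: "\<And>n. \<exists>\<sigma>>0. \<forall>g\<in>G. (\<forall>i<n. g (x i) = x i) \<longrightarrow> g (x n) \<noteq> x n \<longrightarrow> \<sigma> \<le> norm (g (x n) - x n)"
  obtains z s where "rigid_sequence G z s" "z 0 = x 0" "s 0 \<le> R" "\<And>n. x n \<in> span (range z)"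
proof -
  define P where "P n p \<longleftrightarrow> norm (fst p) = 1 \<and> orbit_gap (fst p) (snd p) \<and>
    (\<forall>g\<in>G. g (fst p) = fst p \<longrightarrow> (\<forall>i\<le>n. g (x i) = x i)) \<and> (n = 0 \<longrightarrow> fst p = x 0 \<and> snd p \<le> R)"
    for n and p :: "'a \<times> real"
  define Q where "Q n p p' \<longleftrightarrow> fst p' \<noteq> fst p \<and> norm (fst p' - fst p) \<le> snd p / 100 \<and>
    snd p' \<le> norm (fst p' - fst p) \<and> x (Suc n) \<in> span {fst p, fst p'}"
    for n and p p' :: "'a \<times> real"
  have "\<exists>f. \<forall>n. P n (f n) \<and> Q n (f n) (f (Suc n))"
  proof (rule dependent_nat_choice)
    obtain \<sigma> where \<sigma>: "0 < \<sigma>" "\<forall>g\<in>G. g (x 0) \<noteq> x 0 \<longrightarrow> \<sigma> \<le> norm (g (x 0) - x 0)"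
      using iso[of 0] by auto
    have "P 0 (x 0, min \<sigma> R)"
      unfolding P_def orbit_gap_def using assms \<sigma> by auto
    then show "\<exists>p. P 0 p" by blast
  next
    fix p n assume Pp: "P n p"
    obtain z s where p: "p = (z, s)" by force
    have z: "norm z = 1" "orbit_gap z s" "n = 0 \<Longrightarrow> z = x 0"
      and fixed: "\<And>g i. g \<in> G \<Longrightarrow> g z = z \<Longrightarrow> i \<le> n \<Longrightarrow> g (x i) = x i"
      using Pp by (auto simp: P_def p)
    define w where "w = x (Suc n)"
    have "\<exists>v. v \<notin> span {z} \<and> w \<in> span {z, v} \<and>
        (\<exists>\<sigma>>0. \<forall>g\<in>G. g z = z \<longrightarrow> g v \<noteq> v \<longrightarrow> \<sigma> \<le> norm (g v - v))"
    proof (cases "w \<in> span {z}")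
      case False
      moreover obtain \<sigma> where "0 < \<sigma>"
        "\<forall>g\<in>G. (\<forall>i<Suc n. g (x i) = x i) \<longrightarrow> g w \<noteq> w \<longrightarrow> \<sigma> \<le> norm (g w - w)"
        using iso[of "Suc n"] unfolding w_def by blast
      ultimately show ?thesis
        using fixed by (intro exI[of _ w]) (auto intro: span_base simp: less_Suc_eq_le)
    next
      case True
      \<comment> \<open>The vector \<open>w\<close> is already spanned, but a new direction is still
        needed: \<open>x 0\<close> or \<open>x 1\<close>, whichever is off the line. As
        \<open>1 \<le> n\<close>, the stabilizer of \<open>z\<close> fixes both, so their gap
        condition is vacuous.\<close>
      then have n: "1 \<le> n" using z(3) assms(2) by (cases n) (auto simp: w_def)
      have "\<exists>j\<le>1. x j \<notin> span {z}"
      proof (rule ccontr)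
        assume "\<not> ?thesis"
        then have "x 0 \<in> span {z}" "x 1 \<in> span {z}" by auto
        then obtain c d where cd: "x 0 = c *\<^sub>R z" "x 1 = d *\<^sub>R z" by (auto simp: span_singleton)
        have "c \<noteq> 0" using cd assms(1) by auto
        then have "x 1 = (d / c) *\<^sub>R x 0" using cd by simp
        then show False using assms(2) by (auto simp: span_singleton)
      qed
      then obtain j where j: "j \<le> 1" "x j \<notin> span {z}" by blast
      have "w \<in> span {z, x j}" using True span_mono[of "{z}" "{z, x j}"] by auto
      with j fixed n show ?thesis
        by (intro exI[of _ "x j"] conjI exI[of _ "1::real"]) auto
    qed
    then obtain v \<sigma> where v: "v \<notin> span {z}" "w \<in> span {z, v}" "0 < \<sigma>"
      "\<And>g. g \<in> G \<Longrightarrow> g z = z \<Longrightarrow> g v \<noteq> v \<Longrightarrow> \<sigma> \<le> norm (g v - v)" by blast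
    obtain z' s' where z': "norm z' = 1" "orbit_gap z' s'" "z' \<noteq> z" "norm (z' - z) \<le> s / 100"
      "s' \<le> norm (z' - z)" "v \<in> span {z, z'}" "\<And>g. g \<in> G \<Longrightarrow> g z' = z' \<Longrightarrow> g z = z"
      using extend_by_small_vector[OF z(1,2) v(1,3,4)] by blast
    have "{z, v} \<subseteq> span {z, z'}" using z'(6) by (auto intro: span_base)
    then have w: "w \<in> span {z, z'}" using v(2) span_minimal[OF _ subspace_span] by blast
    have "g w = w" if "g \<in> G" "g z' = z'" for g
    proof -
      have "g z = z" using z'(7) that .
      have lin: "linear (blinfun_apply g)" by (simp add: bounded_linear.linear blinfun.bounded_linear_right)
      show ?thesis
        using linear_eq_on_span[OF lin linear_id, of "{z, z'}"] w \<open>g z = z\<close> that(2) by auto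
    qed
    then have "P (Suc n) (z', s')"
      unfolding P_def using z' fixed by (auto simp: le_Suc_eq w_def)
    moreover have "Q n p (z', s')" unfolding Q_def p using z' w by (simp add: w_def)
    ultimately show "\<exists>p'. P (Suc n) p' \<and> Q n p p'" by blast
  qed
  then obtain f where f: "\<And>n. P n (f n)" "\<And>n. Q n (f n) (f (Suc n))" by blast
  define z where "z n = fst (f n)" for n
  define s where "s n = snd (f n)" for n
  have "rigid_sequence G z s"
    using f unfolding P_def Q_def z_def s_def by unfold_locales auto
  moreover have "z 0 = x 0" "s 0 \<le> R" using f(1)[of 0] by (auto simp: P_def z_def s_def)
  moreover have "x n \<in> span (range z)" for n
  proof (cases n)
    case 0
    then show ?thesis using \<open>z 0 = x 0\<close> by (metis rangeI span_base)
  next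
    case (Suc m)
    have "x n \<in> span {z m, z (Suc m)}" using f(2)[of m] by (simp add: Q_def z_def Suc)
    then show ?thesis using span_mono[of "{z m, z (Suc m)}" "range z"] by auto
  qed
  ultimately show ?thesis using that by blast
qed

end

section \<open>Isometry groups of spiked norms\<close>

text \<open>The strong operator topology is pulled back from the product topology, where convergence
  is pointwise.\<close>

lemma limitin_strong_operator_topology:
  assumes "\<And>v. (\<lambda>n. blinfun_apply (g n) v) \<longlonglongrightarrow> blinfun_apply T v"
  shows "limitin strong_operator_topology g T sequentially"
  unfolding limitin_def
proof (intro conjI allI impI)
  show "T \<in> topspace strong_operator_topology" by (simp add: strong_operator_topology_topspace)
  have lim: "limitin (product_topology (\<lambda>i. euclidean) UNIV) (\<lambda>n. blinfun_apply (g n)) (blinfun_apply T) sequentially"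
    unfolding limitin_componentwise using assms by simp
  fix U assume "openin strong_operator_topology U \<and> T \<in> U"
  then obtain V where "open V" "U = blinfun_apply -` V" "blinfun_apply T \<in> V"
    unfolding strong_operator_topology_def openin_pullback_topology by auto
  then show "\<forall>\<^sub>F n in sequentially. g n \<in> U"
    using lim unfolding limitin_def euclidean_product_topology by auto
qed

text \<open>Isometries are equicontinuous, so three errors \<open>e / 3\<close> suffice.\<close>

lemma tendsto_dense:
  fixes T :: "'a::real_normed_vector \<Rightarrow>\<^sub>L 'a"
  assumes "closure S = UNIV" "\<And>v. v \<in> S \<Longrightarrow> (\<lambda>n. blinfun_apply (g n) v) \<longlonglongrightarrow> T v"
    and "\<And>n v. norm (blinfun_apply (g n) v) = norm v" "\<And>v. norm (T v) = norm v"
  shows "(\<lambda>n. blinfun_apply (g n) v) \<longlonglongrightarrow> T v"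
proof (rule tendstoI)
  fix e :: real assume "0 < e"
  then have "0 < e / 3" by simp
  then obtain u where u: "u \<in> S" "dist u v < e / 3"
    using assms(1) closure_approachable by (metis UNIV_I)
  have "\<forall>\<^sub>F n in sequentially. dist (g n u) (T u) < e / 3"
    using assms(2)[OF u(1)] \<open>0 < e / 3\<close> tendstoD by blast
  then show "\<forall>\<^sub>F n in sequentially. dist (g n v) (T v) < e"
  proof eventually_elim
    case (elim n)
    have "dist (g n v) (g n u) = dist u v" "dist (T u) (T v) = dist u v"
      using assms(3)[of n "v - u"] assms(4)[of "u - v"]
      by (simp_all add: dist_norm blinfun.diff_right norm_minus_commute)
    then show ?case
      using elim u(2) dist_triangle[of "g n v" "T v" "g n u"] dist_triangle[of "g n u" "T v" "T u"]
      by linarith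
  qed
qed

lemma closed_span_singleton:
  fixes z :: "'a::real_normed_vector"
  assumes "norm z = 1"
  shows "closed (span {z})"
proof -
  have "complete (range (\<lambda>c. c *\<^sub>R z))"
  proof (rule complete_isometric_image[of 1])
    show "bounded_linear (\<lambda>c. c *\<^sub>R z)" by (rule bounded_linear_scaleR_left)
  qed (use assms in \<open>auto simp: complete_UNIV\<close>)
  then show ?thesis by (simp add: span_singleton complete_imp_closed)
qed

lemma isometry_group_subgroup:
  assumes "subgroup G (isom_group norm)" "- id_blinfun \<in> G"
  shows "isometry_group G"
proof
  interpret group "isom_group norm" using group_isom_group[OF equivalent_norm_norm] .
  have G: "G \<subseteq> carrier (isom_group norm)" using assms(1) subgroup.subset by blast
  then show "norm (g v) = norm v" if "g \<in> G" for g v using that by (auto simp: isom_group_def)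
  show "g o\<^sub>L h \<in> G" if "g \<in> G" "h \<in> G" for g h
    using subgroup.m_closed[OF assms(1) that] by (simp add: isom_group_def)
  show "\<exists>h\<in>G. \<forall>v. h (g v) = v \<and> g (h v) = v" if "g \<in> G" for g
  proof (intro bexI allI)
    let ?h = "inv\<^bsub>isom_group norm\<^esub> g"
    show "?h \<in> G" using subgroup.m_inv_closed[OF assms(1) that] .
    have "g \<in> carrier (isom_group norm)" using G that by blast
    then have "?h o\<^sub>L g = id_blinfun" "g o\<^sub>L ?h = id_blinfun"
      using l_inv[of g] r_inv[of g] by (simp_all add: isom_group_def)
    then show "?h (g v) = v \<and> g (?h v) = v" for v
      by (metis blinfun_apply_blinfun_compose id_blinfun.rep_eq id_apply)
  qed
qed fact

text \<open>The identity puts \<open>x n\<close> into its own orbit, so discreteness applies at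
  \<open>x n\<close>.\<close>

lemma distinguished_gap:
  assumes "distinguished G L x" "enat n < L" "id_blinfun \<in> G"
  shows "\<exists>\<sigma>>0. \<forall>g\<in>G. (\<forall>i<n. blinfun_apply g (x i) = x i) \<longrightarrow> g (x n) \<noteq> x n \<longrightarrow> \<sigma> \<le> norm (g (x n) - x n)"
proof -
  let ?O = "(\<lambda>g. blinfun_apply g (x n)) ` pointwise_stabilizer G (x ` {..<n})"
  have "id_blinfun (x n) \<in> ?O"
    using assms(3) by (intro imageI) (simp add: pointwise_stabilizer_def)
  then have "x n isolated_in ?O"
    using assms(1,2) discreteD unfolding distinguished_def by fastforce
  then obtain e where "0 < e" "\<And>y. y \<in> ?O \<Longrightarrow> dist (x n) y < e \<Longrightarrow> y = x n"
    unfolding isolated_in_dist_Ex_iff by blast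
  then show ?thesis
    by (intro exI[of _ e]) (force simp: pointwise_stabilizer_def dist_norm norm_minus_commute)
qed

text \<open>The new sequence is infinite even if \<open>L\<close> is finite: the distance from \<open>z\<^sub>n\<close> to the other
  orbits labels the orbit of \<open>z\<^sub>n\<close> only if there is no last \<open>n\<close>.\<close>

lemma (in isometry_group) reindexed_gaps:
  assumes gaps: "\<And>n. enat n < L \<Longrightarrow> \<exists>\<sigma>>0. \<forall>g\<in>G. (\<forall>i<n. g (x i) = x i) \<longrightarrow> g (x n) \<noteq> x n \<longrightarrow> \<sigma> \<le> norm (g (x n) - x n)"
    and "0 < L" "enat k < L" "x k \<notin> span {x 0}"
  obtains y :: "nat \<Rightarrow> 'a" where "y 0 = x 0" "y 1 \<notin> span {x 0}" "\<And>n. enat n < L \<Longrightarrow> x n \<in> range y"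
    "\<And>n. \<exists>\<sigma>>0. \<forall>g\<in>G. (\<forall>i<n. g (y i) = y i) \<longrightarrow> g (y n) \<noteq> y n \<longrightarrow> \<sigma> \<le> norm (g (y n) - y n)"
proof -
  define k' where "k' = (LEAST k. enat k < L \<and> x k \<notin> span {x 0})"
  have k': "enat k' < L" "x k' \<notin> span {x 0}"
    using LeastI[of "\<lambda>k. enat k < L \<and> x k \<notin> span {x 0}"] assms unfolding k'_def by blast+
  have least: "x i \<in> span {x 0}" if "i < k'" for i
    using not_less_Least[of i "\<lambda>k. enat k < L \<and> x k \<notin> span {x 0}"] that k'(1)
    unfolding k'_def by (metis enat_ord_simps(2) order_less_trans)
  \<comment> \<open>A vector off the line moves to index 1, then the whole sequence follows, padded
    with \<open>x 0\<close> if \<open>L\<close> is finite. Repetitions are harmless: a vector that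
    occurred before is fixed by the stabilizer.\<close>
  define y where "y n = (case n of 0 \<Rightarrow> x 0 | Suc 0 \<Rightarrow> x k' | Suc (Suc m) \<Rightarrow> if enat m < L then x m else x 0)" for n
  have y: "y 0 = x 0" "y (Suc 0) = x k'" "\<And>m. enat m < L \<Longrightarrow> y (Suc (Suc m)) = x m"
    "\<And>m. \<not> enat m < L \<Longrightarrow> y (Suc (Suc m)) = x 0"
    by (auto simp: y_def)
  have "\<exists>\<sigma>>0. \<forall>g\<in>G. (\<forall>i<n. g (y i) = y i) \<longrightarrow> g (y n) \<noteq> y n \<longrightarrow> \<sigma> \<le> norm (g (y n) - y n)" for n
  proof -
    consider "n = 0" | "n = 1" | m where "n = Suc (Suc m)" "enat m < L" | m where "n = Suc (Suc m)" "\<not> enat m < L"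
      by (metis One_nat_def not0_implies_Suc)
    then show ?thesis
    proof cases
      case 1
      then show ?thesis using gaps[of 0] \<open>0 < L\<close> y(1) by (simp add: zero_enat_def)
    next
      case 2
      \<comment> \<open>The vectors before \<open>x k'\<close> are multiples of \<open>x 0\<close>, so omitting them does not enlarge the stabilizer.\<close>
      have "g (x i) = x i" if g0: "g (x 0) = x 0" and i: "i < k'" for g :: "'a \<Rightarrow>\<^sub>L 'a" and i
      proof -
        obtain c where "x i = c *\<^sub>R x 0" using least[OF i] by (auto simp: span_singleton)
        then show ?thesis using g0 by (simp add: blinfun.scaleR_right)
      qed
      then show ?thesis using gaps[OF k'(1)] 2 y(1,2) by (simp, metis)
    next
      case (3 m)
      have "g (x i) = x i" if "\<forall>j<n. g (y j) = y j" "i < m" for g :: "'a \<Rightarrow>\<^sub>L 'a" and i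
      proof -
        have "enat i < L" using that(2) 3(2) by (metis enat_ord_simps(2) order_less_trans)
        then show ?thesis using that(1)[rule_format, of "Suc (Suc i)"] that(2) y(3) 3(1) by simp
      qed
      then show ?thesis using gaps[OF 3(2)] y(3)[OF 3(2)] unfolding 3(1)[symmetric] by metis
    next
      case (4 m)
      then show ?thesis using y(1) y(4) by (intro exI[of _ "1::real"]) force
    qed
  qed
  moreover have "x n \<in> range y" if "enat n < L" for n using y(3)[OF that] by (metis rangeI)
  ultimately show ?thesis using that[of y] y k' by simp
qed

theorem theorem19:
  fixes G :: "('a::banach \<Rightarrow>\<^sub>L 'a) set"
    and x :: "nat \<Rightarrow> 'a"
    and L :: enat
  assumes "separable_space (euclidean :: 'a topology)"
    and "subgroup G (isom_group norm)"
    and "closedin (subtopology strong_operator_topology (carrier (isom_group norm))) G"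
    and "- id_blinfun \<in> G"
    and "0 < L"
    and "\<And>n. enat n < L \<Longrightarrow> x n \<in> sphere 0 1"
    and "distinguished G L x"
    and "closure (span (x ` {n. enat n < L})) = UNIV"
    and "LUR_near (x 0)"
  shows "\<exists>N. equivalent_norm N \<and> G = carrier (isom_group N)"
proof -
  interpret isometry_group G using assms(2,4) by (rule isometry_group_subgroup)
  have G_carrier: "G \<subseteq> carrier (isom_group norm)" using assms(2) subgroup.subset by blast
  have x0: "norm (x 0) = 1" using assms(5) assms(6)[of 0] by (simp add: zero_enat_def)
  show ?thesis
  proof (cases "\<forall>k. enat k < L \<longrightarrow> x k \<in> span {x 0}")
    \<comment> \<open>The space is a line, on which the only isometries are plus and minus the
      identity; the original norm serves.\<close>
    case True
    then have "span (x ` {n. enat n < L}) \<subseteq> span {x 0}" by (intro span_minimal) auto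
    then have "closure (span (x ` {n. enat n < L})) \<subseteq> span {x 0}"
      using closure_minimal closed_span_singleton[OF x0] by blast
    then have line: "\<exists>c. v = c *\<^sub>R x 0" for v using assms(8) by (auto simp: span_singleton)
    have "T \<in> G" if T: "T \<in> carrier (isom_group norm)" for T
    proof -
      obtain c where c: "T (x 0) = c *\<^sub>R x 0" using line by blast
      have "norm (T (x 0)) = 1" using T x0 by (simp add: isom_group_def)
      then have "c = 1 \<or> c = -1" using c x0 by (simp add: abs_if split: if_splits)
      moreover have "T = c *\<^sub>R id_blinfun"
      proof (rule blinfun_eqI)
        fix v
        obtain d where "v = d *\<^sub>R x 0" using line by blast
        then show "T v = (c *\<^sub>R id_blinfun) v" by (simp add: blinfun.scaleR_right blinfun.scaleR_left c)
      qed
      ultimately show ?thesis using id minus_id by auto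
    qed
    then show ?thesis using G_carrier equivalent_norm_norm by blast
  next
    case False
    then obtain k where "enat k < L" "x k \<notin> span {x 0}" by blast
    then obtain y :: "nat \<Rightarrow> 'a" where y: "y 0 = x 0" "y 1 \<notin> span {x 0}" "\<And>n. enat n < L \<Longrightarrow> x n \<in> range y"
      "\<And>n. \<exists>\<sigma>>0. \<forall>g\<in>G. (\<forall>i<n. g (y i) = y i) \<longrightarrow> g (y n) \<noteq> y n \<longrightarrow> \<sigma> \<le> norm (g (y n) - y n)"
      using reindexed_gaps[OF distinguished_gap[OF assms(7) _ id] assms(5)] by blast
    obtain U where U: "open U" "x 0 \<in> U" "\<And>v. v \<in> U \<Longrightarrow> norm v = 1 \<Longrightarrow> LUR_at v"
      using assms(9) unfolding LUR_near_def by auto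
    obtain R where R: "0 < R" "ball (x 0) R \<subseteq> U" using U openE by blast
    obtain z s where "rigid_sequence G z s" and z0: "z 0 = x 0" "s 0 \<le> R"
      and y_span: "\<And>n. y n \<in> span (range z)"
      using rigid_sequence_exists[of y R] y R x0 by metis
    then interpret rigid_sequence G z s by blast
    have LUR: "LUR_at (z n)" for n
    proof -
      \<comment> \<open>The whole sequence stays within \<open>2 * \<tau> 0 \<le> R / 50\<close> of
        \<open>x 0\<close>, where the norm is LUR.\<close>
      have "dist (x 0) (z n) < R"
        using tail_le'[of 0 n] tau_gap[of 0] tau_pos[of 0] z0 by (simp add: dist_norm norm_minus_commute)
      then show ?thesis using R U unit by auto
    qed
    have "span (x ` {n. enat n < L}) \<subseteq> span (range z)"
      using y(3) y_span by (intro span_minimal) (fastforce simp: image_iff)+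
    then have dense: "closure (span (range z)) = UNIV"
      using assms(8) closure_mono by blast
    have "T \<in> G" if T: "T \<in> carrier (isom_group N)" for T
    proof -
      interpret N: group "isom_group N" by (rule group_isom_group[OF equivalent_N])
      define S where "S = inv\<^bsub>isom_group N\<^esub> T"
      have "S o\<^sub>L T = id_blinfun" "T o\<^sub>L S = id_blinfun"
        using N.l_inv[OF T] N.r_inv[OF T] by (simp_all add: S_def isom_group_def)
      then have ST: "S (T v) = v" "T (S v) = v" for v
        by (metis blinfun_apply_blinfun_compose id_blinfun.rep_eq id_apply)+
      have lin: "linear (blinfun_apply A)" for A :: "'a \<Rightarrow>\<^sub>L 'a"
        by (simp add: bounded_linear.linear blinfun.bounded_linear_right)
      have "N (T v) = N v" for v using T by (simp add: isom_group_def)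
      then obtain g where g: "\<And>n. g n \<in> G" "\<And>n i. i \<le> n \<Longrightarrow> T (z i) = blinfun_apply (g n) (z i)"
        using isometry_agrees[OF LUR lin ST(1) lin ST(2)] by blast
      \<comment> \<open>A vector of the span involves finitely many \<open>z i\<close>, so
        \<open>g n\<close> and \<open>T\<close> eventually agree on it.\<close>
      let ?E = "{v. \<forall>\<^sub>F n in sequentially. blinfun_apply (g n) v = T v}"
      have "span (range z) \<subseteq> ?E"
      proof (rule span_minimal)
        show "range z \<subseteq> ?E"
        proof clarify
          fix i
          show "\<forall>\<^sub>F n in sequentially. g n (z i) = T (z i)"
            using eventually_ge_at_top[of i] by eventually_elim (simp add: g)
        qed
        show "subspace ?E"
          unfolding subspace_def
          by (auto simp: blinfun.add_right blinfun.scaleR_right elim: eventually_elim2 eventually_mono)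
      qed
      then have agree: "\<forall>\<^sub>F n in sequentially. g n v = T v" if "v \<in> span (range z)" for v
        using that by blast
      \<comment> \<open>So far \<open>T\<close> preserves only \<open>N\<close>. It preserves the
        original norm on the span because the \<open>g n\<close> do, and everywhere by
        density.\<close>
      have "span (range z) \<subseteq> {v. norm (T v) = norm v}"
      proof clarify
        fix v assume "v \<in> span (range z)"
        then obtain n where "g n v = T v" using agree eventually_happens' sequentially_bot by blast
        then show "norm (T v) = norm v" using isometry[OF g(1)[of n], of v] by simp
      qed
      moreover have "closed {v. norm (T v) = norm v}"
        by (intro closed_Collect_eq continuous_intros)
      ultimately have "closure (span (range z)) \<subseteq> {v. norm (T v) = norm v}"
        by (rule closure_minimal)
      then have T_norm: "norm (T v) = norm v" for v using dense by blast
      have "(\<lambda>n. g n v) \<longlonglongrightarrow> T v" for v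
      proof (rule tendsto_dense[OF dense _ _ T_norm])
        show "(\<lambda>n. g n v) \<longlonglongrightarrow> T v" if "v \<in> span (range z)" for v
          using agree[OF that] by (rule tendsto_eventually)
      qed (use isometry g(1) in blast)
      then have lim: "limitin strong_operator_topology g T sequentially"
        by (rule limitin_strong_operator_topology)
      \<comment> \<open>\<open>G\<close> is closed only relative to this group, so membership of
        \<open>T\<close> in it comes first.\<close>
      have "T \<in> carrier (isom_group norm)"
        using T T_norm by (simp add: isom_group_def)
      moreover obtain K where K: "closedin strong_operator_topology K" "G = K \<inter> carrier (isom_group norm)"
        using assms(3) unfolding closedin_subtopology by blast
      moreover have "T \<in> K"
        using limitin_closedin[OF lim K(1)] g(1) K(2) by simp
      ultimately show ?thesis by blast
    qed
    moreover have "g \<in> carrier (isom_group N)" if "g \<in> G" for g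
      using that G_carrier N_invariant[OF that] by (auto simp: isom_group_def)
    ultimately show ?thesis using equivalent_N by blast
  qed
qed

end
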